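(* Let $\omega\subset\mathbb{R}^2$ be a bounded and connected open set with Lipschitz-continuous boundary. Assume that the set $V(\omega)=V_H(\omega)\times V_3(\omega)$, where $V_H(\omega)\subset H^1(\omega)\times H^1(\omega)$ and $V_3(\omega)\subset H^2(\omega)$, satisfies the following two conditions: $$u_3\in V_3(\omega)\ \text{ and }\ \partial_\alpha u_3=0\text{ in }\omega\text{ for all }\alpha\in\{1,2\}\quad\text{imply}\quad u_3=0\text{ in }\omega,$$ and $$(u_\alpha)\in V_H(\omega)\quad\text{implies}\quad u_\alpha=0\text{ on }\partial\omega\text{ for all }\alpha\in\{1,2\}.$$ Then the set $V(\omega)$ satisfies the following rigidity property: $$\boldsymbol{u}\in V(\omega)\ \text{ and }\ \boldsymbol{E}(\boldsymbol{u})=\boldsymbol{0}\text{ in }\omega\quad\text{imply}\quad\boldsymbol{u}=\boldsymbol{0}\text{ in }\omega.$$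
   Context: For $\boldsymbol{u}=(u_1,u_2,u_3)\in H^1(\omega)\times H^1(\omega)\times H^2(\omega)$, the symmetric matrix field $\boldsymbol{E}(\boldsymbol{u})=(E_{\alpha\beta}(\boldsymbol{u}))_{\alpha,\beta\in\{1,2\}}$ is defined by $$E_{\alpha\beta}(\boldsymbol{u})=\tfrac12(\partial_\alpha u_\beta+\partial_\beta u_\alpha+\partial_\alpha u_3\,\partial_\beta u_3),$$ where $\partial_\alpha=\partial/\partial y_\alpha$ are distributional derivatives. Boundary values are understood in the sense of traces. *)

theory Defs
  imports "HOL-Analysis.Analysis"
begin

definition partial_deriv :: "'n \<Rightarrow> (real^'n \<Rightarrow> real) \<Rightarrow> real^'n \<Rightarrow> real" where
  "partial_deriv i f x = frechet_derivative f (at x) (axis i 1)"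

primrec Ck :: "nat \<Rightarrow> (real^'n \<Rightarrow> real) \<Rightarrow> bool" where
  "Ck 0 f \<longleftrightarrow> continuous_on UNIV f"
| "Ck (Suc k) f \<longleftrightarrow> (\<forall>x. f differentiable (at x)) \<and> (\<forall>i. Ck k (partial_deriv i f))"

definition smooth :: "(real^'n \<Rightarrow> real) \<Rightarrow> bool" where
  "smooth f \<longleftrightarrow> (\<forall>k. Ck k f)"

definition test_functions :: "(real^'n) set \<Rightarrow> (real^'n \<Rightarrow> real) set" where
  "test_functions \<omega> =
     {\<phi>. smooth \<phi> \<and> compact (closure {x. \<phi> x \<noteq> 0}) \<and> closure {x. \<phi> x \<noteq> 0} \<subseteq> \<omega>}"

text \<open>
  Elements of the function spaces below are represented by functions on the whole space of
  which only the values in \<open>\<omega>\<close>, up to a Lebesgue null set, are relevant. Accordingly,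
  ``in \<open>\<omega>\<close>'' means almost everywhere with respect to Lebesgue measure on \<open>\<omega>\<close>.
\<close>

definition L1_loc :: "(real^'n) set \<Rightarrow> (real^'n \<Rightarrow> real) set" where
  "L1_loc \<omega> = {f. \<forall>K. compact K \<and> K \<subseteq> \<omega> \<longrightarrow> integrable (lebesgue_on K) f}"

definition L2 :: "(real^'n) set \<Rightarrow> (real^'n \<Rightarrow> real) set" where
  "L2 \<omega> = {f \<in> borel_measurable (lebesgue_on \<omega>). integrable (lebesgue_on \<omega>) (\<lambda>x. (f x)\<^sup>2)}"

definition has_weak_partial ::
    "(real^'n) set \<Rightarrow> 'n \<Rightarrow> (real^'n \<Rightarrow> real) \<Rightarrow> (real^'n \<Rightarrow> real) \<Rightarrow> bool" where
  "has_weak_partial \<omega> i f g \<longleftrightarrow> f \<in> L1_loc \<omega> \<and> g \<in> L1_loc \<omega> \<and>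
     (\<forall>\<phi> \<in> test_functions \<omega>.
        (LINT x|lebesgue_on \<omega>. f x * partial_deriv i \<phi> x) = - (LINT x|lebesgue_on \<omega>. g x * \<phi> x))"

text \<open>A representative of the distributional derivative, whenever that is a function; it is
  unique up to a null set.\<close>

definition weak_partial :: "(real^'n) set \<Rightarrow> 'n \<Rightarrow> (real^'n \<Rightarrow> real) \<Rightarrow> real^'n \<Rightarrow> real" where
  "weak_partial \<omega> i f = (SOME g. has_weak_partial \<omega> i f g)"

definition H1 :: "(real^'n) set \<Rightarrow> (real^'n \<Rightarrow> real) set" where
  "H1 \<omega> = {f \<in> L2 \<omega>. \<forall>i. \<exists>g \<in> L2 \<omega>. has_weak_partial \<omega> i f g}"

definition H2 :: "(real^'n) set \<Rightarrow> (real^'n \<Rightarrow> real) set" where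
  "H2 \<omega> = {f \<in> L2 \<omega>. \<forall>i. \<exists>g \<in> H1 \<omega>. has_weak_partial \<omega> i f g}"

definition H1_norm :: "(real^'n) set \<Rightarrow> (real^'n \<Rightarrow> real) \<Rightarrow> real" where
  "H1_norm \<omega> f = sqrt ((LINT x|lebesgue_on \<omega>. (f x)\<^sup>2) +
     (\<Sum>i\<in>UNIV. LINT x|lebesgue_on \<omega>. (weak_partial \<omega> i f x)\<^sup>2))"

text \<open>Near each boundary point, after a rotation or reflection of the coordinates, the set lies
  strictly on one side of the graph of a Lipschitz function.\<close>

definition lipschitz_boundary :: "(real^2) set \<Rightarrow> bool" where
  "lipschitz_boundary \<omega> \<longleftrightarrow>
     (\<forall>z \<in> frontier \<omega>. \<exists>r > 0. \<exists>(T :: real^2 \<Rightarrow> real^2) \<gamma> L.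
        orthogonal_transformation T \<and> L-lipschitz_on UNIV \<gamma> \<and>
        \<omega> \<inter> ball z r = {x \<in> ball z r. \<gamma> (T x $ 1) < T x $ 2})"

text \<open>One-dimensional Hausdorff measure. The boundedness condition is needed because
  \<^const>\<open>diameter\<close> is meaningless for unbounded sets. Since the outer measure is a metric outer
  measure, it is countably additive on the Borel sets, so that \<^const>\<open>measure_of\<close> does not
  degenerate. On a Lipschitz curve it is arc length.\<close>

definition hausdorff1_pre :: "real \<Rightarrow> 'a::metric_space set \<Rightarrow> ennreal" where
  "hausdorff1_pre \<delta> A =
     (INF U \<in> {U :: nat \<Rightarrow> 'a set. (\<forall>i. bounded (U i) \<and> diameter (U i) \<le> \<delta>) \<and> A \<subseteq> (\<Union>i. U i)}.
        \<Sum>i. ennreal (diameter (U i)))"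

definition hausdorff1_outer :: "'a::metric_space set \<Rightarrow> ennreal" where
  "hausdorff1_outer A = (SUP \<delta> \<in> {0<..}. hausdorff1_pre \<delta> A)"

definition hausdorff1 :: "'a::metric_space measure" where
  "hausdorff1 = measure_of UNIV (sets borel) hausdorff1_outer"

definition boundary_measure :: "(real^2) set \<Rightarrow> (real^2) measure" where
  "boundary_measure \<omega> = restrict_space hausdorff1 (frontier \<omega>)"

text \<open>The trace operator is the extension by density, from smooth functions to \<open>H\<^sup>1(\<omega>)\<close>, of the
  restriction to the boundary with values in \<open>L\<^sup>2(\<partial>\<omega>)\<close>. It is given here by its graph; by the
  trace theorem, on a bounded Lipschitz domain each \<open>f\<close> in \<open>H\<^sup>1(\<omega>)\<close> has a trace, unique almost
  everywhere on the boundary and independent of the approximating sequence.\<close>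

definition has_trace ::
    "(real^2) set \<Rightarrow> (real^2 \<Rightarrow> real) \<Rightarrow> (real^2 \<Rightarrow> real) \<Rightarrow> bool" where
  "has_trace \<omega> f g \<longleftrightarrow> f \<in> H1 \<omega> \<and>
     g \<in> borel_measurable (boundary_measure \<omega>) \<and> integrable (boundary_measure \<omega>) (\<lambda>x. (g x)\<^sup>2) \<and>
     (\<exists>\<phi> :: nat \<Rightarrow> real^2 \<Rightarrow> real. (\<forall>n. smooth (\<phi> n)) \<and>
        (\<lambda>n. H1_norm \<omega> (\<lambda>x. \<phi> n x - f x)) \<longlonglongrightarrow> 0 \<and>
        (\<lambda>n. \<integral>\<^sup>+ x. ennreal ((\<phi> n x - g x)\<^sup>2) \<partial>boundary_measure \<omega>) \<longlonglongrightarrow> 0)"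

text \<open>A displacement field is a pair of the family of its two horizontal components
  and its vertical component.\<close>

type_synonym displacement = "(2 \<Rightarrow> real^2 \<Rightarrow> real) \<times> (real^2 \<Rightarrow> real)"

definition strain :: "(real^2) set \<Rightarrow> displacement \<Rightarrow> real^2 \<Rightarrow> real^2^2" where
  "strain \<omega> u y = (case u of (uH, u3) \<Rightarrow>
     \<chi> \<alpha> \<beta>. (1/2) * (weak_partial \<omega> \<alpha> (uH \<beta>) y + weak_partial \<omega> \<beta> (uH \<alpha>) y
                      + weak_partial \<omega> \<alpha> u3 y * weak_partial \<omega> \<beta> u3 y))"

end

theory Submission imports Defs begin

text \<open>
  The diagonal part of \<open>E(u) = 0\<close> says \<open>\<partial>\<^sub>\<alpha> u\<^sub>\<alpha> = - (\<partial>\<^sub>\<alpha> u\<^sub>3)\<^sup>2 / 2 \<le> 0\<close>, so it suffices that a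
  function \<open>f\<close> of zero trace with \<open>\<partial>\<^sub>\<alpha> f \<le> 0\<close> vanishes: then \<open>u\<^sub>\<alpha> = 0\<close>, hence \<open>\<partial>\<^sub>\<alpha> u\<^sub>3 = 0\<close> and
  \<open>u\<^sub>3 = 0\<close>. Integrating \<open>\<partial>\<^sub>\<alpha> (f \<bar>f\<bar>)\<close> over \<open>\<omega>\<close> gives \<open>\<integral> \<bar>f\<bar> \<partial>\<^sub>\<alpha> f = 0\<close>, that is \<open>f \<partial>\<^sub>\<alpha> f = 0\<close>, and
  integrating \<open>\<partial>\<^sub>\<alpha> (y\<^sub>\<alpha> f\<^sup>2)\<close> then gives \<open>\<integral> f\<^sup>2 = 0\<close>. Both integrations are done on smooth
  approximations, where the boundary term is controlled by the estimate
  \<open>\<bar>\<integral>\<^sub>\<omega> \<partial>\<^sub>\<alpha> F\<bar> \<le> 2 \<integral> \<bar>F\<bar> dH\<^sup>1\<close> over the boundary. It holds for every bounded open set: slice by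
  lines parallel to the \<open>\<alpha>\<close> axis and use that projections do not increase Hausdorff measure.
\<close>

section \<open>Hausdorff measure\<close>

text \<open>Two notions in the statement give no information by themselves.
  \<open>measure_of\<close> yields the zero measure unless countable additivity on the generated
  sigma-algebra is proved, so the Hausdorff outer measure must first be shown to be additive on
  Borel sets. \<open>weak_partial\<close> is a \<open>SOME\<close> value, so anything said about it,
  and about \<open>H1_norm\<close>, rests on almost-everywhere uniqueness, that is, on the
  fundamental lemma of the calculus of variations and hence on a supply of smooth bump functions.
  The choice of f |f| comes from two demands: a zero trace is a limit in L^2 of the boundary, so the
  integrated function should grow quadratically in f, and its derivative 2 |f| df should keep the
  sign of df. The weight y_i has derivative 1 in direction i, so it releases f^2 undifferentiated,
  as in the proof of the Poincare inequality; the other term of the product rule contains f df,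
  which is already known to vanish. The factor 2 in the boundary estimate reflects that one boundary
  point may end one interval of a slice and begin the next.\<close>

lemma hausdorff1_pre_mono_set: "A \<subseteq> B \<Longrightarrow> hausdorff1_pre \<delta> A \<le> hausdorff1_pre \<delta> B"
  unfolding hausdorff1_pre_def by (rule INF_superset_mono) auto

lemma hausdorff1_outer_mono: "A \<subseteq> B \<Longrightarrow> hausdorff1_outer A \<le> hausdorff1_outer B"
  unfolding hausdorff1_outer_def by (rule SUP_mono) (auto intro: hausdorff1_pre_mono_set)

lemma hausdorff1_pre_le:
  assumes "\<And>i. bounded (U i)" "\<And>i. diameter (U i) \<le> \<delta>" "A \<subseteq> (\<Union>i. U i)"
  shows "hausdorff1_pre \<delta> A \<le> (\<Sum>i. ennreal (diameter (U i)))"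
  unfolding hausdorff1_pre_def by (rule INF_lower) (use assms in auto)

lemma hausdorff1_pre_le_outer: "0 < \<delta> \<Longrightarrow> hausdorff1_pre \<delta> A \<le> hausdorff1_outer A"
  unfolding hausdorff1_outer_def by (rule SUP_upper) auto

lemma hausdorff1_pre_antimono: "\<delta> \<le> \<delta>' \<Longrightarrow> hausdorff1_pre \<delta>' A \<le> hausdorff1_pre \<delta> A"
  unfolding hausdorff1_pre_def by (rule INF_superset_mono) (auto intro: order_trans)

lemma hausdorff1_pre_cover:
  assumes "hausdorff1_pre \<delta> A < t"
  obtains U where "\<And>i::nat. bounded (U i)" "\<And>i. diameter (U i) \<le> \<delta>" "A \<subseteq> (\<Union>i. U i)"
    "(\<Sum>i. ennreal (diameter (U i))) < t"
  using assms unfolding hausdorff1_pre_def INF_less_iff by blast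

lemma hausdorff1_pre_empty: "0 < \<delta> \<Longrightarrow> hausdorff1_pre \<delta> {} = 0"
  using hausdorff1_pre_le[of "\<lambda>_. {}" \<delta> "{}"] by simp

lemma hausdorff1_outer_empty: "hausdorff1_outer {} = 0"
  unfolding hausdorff1_outer_def by (rule SUP_eq_const) (auto simp: hausdorff1_pre_empty)

lemma hausdorff1_pre_Union_le:
  assumes \<delta>: "0 < \<delta>"
  shows "hausdorff1_pre \<delta> (\<Union>n::nat. A n) \<le> (\<Sum>n. hausdorff1_pre \<delta> (A n))"
proof (rule ennreal_le_epsilon)
  fix e :: real
  assume fin: "(\<Sum>n. hausdorff1_pre \<delta> (A n)) < top" and e: "0 < e"
  have "\<exists>U. (\<forall>i::nat. bounded (U i) \<and> diameter (U i) \<le> \<delta>) \<and> A n \<subseteq> (\<Union>i. U i) \<and>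
      (\<Sum>i. ennreal (diameter (U i))) \<le> hausdorff1_pre \<delta> (A n) + ennreal (e * (1/2)^Suc n)" for n
  proof -
    \<comment> \<open>Finiteness makes the next inequality strict, as the choice of a nearly optimal
      cover requires. The exponent \<open>Suc n\<close> starts at 1, so the slacks add up to exactly
      \<open>e\<close>.\<close>
    have "hausdorff1_pre \<delta> (A n) < top"
      using fin ennreal_suminf_lessD by blast
    then have "hausdorff1_pre \<delta> (A n) < hausdorff1_pre \<delta> (A n) + ennreal (e * (1/2)^Suc n)"
      using e by simp
    from hausdorff1_pre_cover[OF this] show ?thesis by (metis less_imp_le)
  qed
  then obtain U where U: "\<And>n i::nat. bounded (U n i)" "\<And>n i. diameter (U n i) \<le> \<delta>"
    "\<And>n. A n \<subseteq> (\<Union>i. U n i)"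
    "\<And>n. (\<Sum>i. ennreal (diameter (U n i))) \<le> hausdorff1_pre \<delta> (A n) + ennreal (e * (1/2)^Suc n)"
    by metis
  let ?V = "\<lambda>k. U (fst (prod_decode k)) (snd (prod_decode k))"
  have cov: "(\<Union>n. A n) \<subseteq> (\<Union>k. ?V k)"
  proof
    fix x assume "x \<in> (\<Union>n. A n)"
    then obtain n i where "x \<in> U n i" using U(3) by blast
    then have "x \<in> ?V (prod_encode (n, i))" by simp
    then show "x \<in> (\<Union>k. ?V k)" by blast
  qed
  have "hausdorff1_pre \<delta> (\<Union>n. A n) \<le> (\<Sum>k. ennreal (diameter (?V k)))"
    by (rule hausdorff1_pre_le) (use U cov in auto)
  also have "\<dots> = (\<Sum>n i. ennreal (diameter (U n i)))"
    using suminf_ennreal_2dimen[of "\<lambda>n. (\<Sum>i. ennreal (diameter (U n i)))"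
        "\<lambda>(n, i). ennreal (diameter (U n i))"] by (simp add: case_prod_beta comp_def)
  also have "\<dots> \<le> (\<Sum>n. hausdorff1_pre \<delta> (A n) + ennreal (e * (1/2)^Suc n))"
    by (intro suminf_le U) auto
  also have "\<dots> = (\<Sum>n. hausdorff1_pre \<delta> (A n)) + (\<Sum>n. ennreal (e * (1/2)^Suc n))"
    by (rule suminf_add[symmetric]) auto
  also have "(\<Sum>n. ennreal (e * (1/2)^Suc n)) = ennreal e"
  proof -
    have "(\<lambda>n. e * (1/2)^Suc n) sums (e * 1)"
      by (intro sums_mult power_half_series)
    then show ?thesis using e by (intro suminf_ennreal_eq) auto
  qed
  finally show "hausdorff1_pre \<delta> (\<Union>n. A n) \<le> (\<Sum>n. hausdorff1_pre \<delta> (A n)) + ennreal e" .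
qed

lemma hausdorff1_outer_Union_le:
  "hausdorff1_outer (\<Union>n::nat. A n) \<le> (\<Sum>n. hausdorff1_outer (A n))"
  unfolding hausdorff1_outer_def[of "\<Union>n. A n"]
proof (rule SUP_least)
  fix \<delta> :: real assume "\<delta> \<in> {0<..}"
  then have \<delta>: "0 < \<delta>" by simp
  have "hausdorff1_pre \<delta> (\<Union>n. A n) \<le> (\<Sum>n. hausdorff1_pre \<delta> (A n))"
    by (rule hausdorff1_pre_Union_le[OF \<delta>])
  also have "\<dots> \<le> (\<Sum>n. hausdorff1_outer (A n))"
    by (intro suminf_le hausdorff1_pre_le_outer \<delta>) auto
  finally show "hausdorff1_pre \<delta> (\<Union>n. A n) \<le> (\<Sum>n. hausdorff1_outer (A n))" .
qed

section \<open>Metric outer measure and measurability of Borel sets\<close>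

lemma outer_measure_space_hausdorff1: "outer_measure_space (Pow UNIV) hausdorff1_outer"
  unfolding outer_measure_space_def positive_def increasing_def countably_subadditive_def
  by (auto simp: hausdorff1_outer_empty hausdorff1_outer_mono hausdorff1_outer_Union_le)

lemma hausdorff1_outer_Un_le: "hausdorff1_outer (A \<union> B) \<le> hausdorff1_outer A + hausdorff1_outer B"
proof -
  have "hausdorff1_outer (\<Union>n::nat. if n = 0 then A else if n = 1 then B else {})
     \<le> (\<Sum>n::nat. hausdorff1_outer (if n = 0 then A else if n = 1 then B else {}))"
    by (rule hausdorff1_outer_Union_le)
  also have "\<dots> = (\<Sum>n\<in>{0,1}. hausdorff1_outer (if n = 0 then A else if n = (1::nat) then B else {}))"
    by (rule suminf_finite) (auto simp: hausdorff1_outer_empty)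
  also have "(\<Union>n::nat. if n = 0 then A else if n = 1 then B else {}) = A \<union> B"
    by (auto split: if_splits)
  finally show ?thesis by simp
qed

text \<open>A set of diameter at most \<open>\<delta>\<close> < \<open>d\<close> cannot meet both
  \<open>A\<close> and \<open>B\<close>, so every cover of the union splits into a cover of
  \<open>A\<close> and a cover of \<open>B\<close> that share no nonempty set.\<close>

lemma hausdorff1_pre_separated:
  assumes d: "\<And>x y. x \<in> A \<Longrightarrow> y \<in> B \<Longrightarrow> d \<le> dist x y" and \<delta>: "0 < \<delta>" "\<delta> < d"
  shows "hausdorff1_pre \<delta> A + hausdorff1_pre \<delta> B \<le> hausdorff1_pre \<delta> (A \<union> B)"
  unfolding hausdorff1_pre_def[of \<delta> "A \<union> B"]
proof (rule INF_greatest)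
  fix U :: "nat \<Rightarrow> 'a set"
  assume "U \<in> {U. (\<forall>i. bounded (U i) \<and> diameter (U i) \<le> \<delta>) \<and> A \<union> B \<subseteq> (\<Union>i. U i)}"
  then have U: "\<And>i. bounded (U i)" "\<And>i. diameter (U i) \<le> \<delta>" "A \<union> B \<subseteq> (\<Union>i. U i)" by auto
  let ?P = "\<lambda>S i. if U i \<inter> S = {} then {} else U i"
  have P: "hausdorff1_pre \<delta> S \<le> (\<Sum>i. ennreal (diameter (?P S i)))" if S: "S \<subseteq> A \<union> B" for S
  proof (rule hausdorff1_pre_le)
    show "S \<subseteq> (\<Union>i. ?P S i)"
    proof
      fix x assume "x \<in> S"
      moreover obtain i where "x \<in> U i" using \<open>x \<in> S\<close> S U(3) by blast
      ultimately have "x \<in> ?P S i" by auto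
      then show "x \<in> (\<Union>i. ?P S i)" by blast
    qed
  qed (use U \<delta> in auto)
  have "hausdorff1_pre \<delta> A + hausdorff1_pre \<delta> B
      \<le> (\<Sum>i. ennreal (diameter (?P A i))) + (\<Sum>i. ennreal (diameter (?P B i)))"
    by (intro add_mono P) auto
  also have "\<dots> = (\<Sum>i. ennreal (diameter (?P A i)) + ennreal (diameter (?P B i)))"
    by (rule suminf_add) auto
  also have "\<dots> \<le> (\<Sum>i. ennreal (diameter (U i)))"
  proof (intro suminf_le)
    fix i
    have "U i \<inter> A = {} \<or> U i \<inter> B = {}"
    proof (rule ccontr)
      assume "\<not> ?thesis"
      then obtain x y where "x \<in> U i" "x \<in> A" "y \<in> U i" "y \<in> B" by blast
      then have "d \<le> dist x y" "dist x y \<le> diameter (U i)"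
        using d diameter_bounded_bound U(1) by blast+
      then show False using U(2)[of i] \<delta> by linarith
    qed
    then show "ennreal (diameter (?P A i)) + ennreal (diameter (?P B i)) \<le> ennreal (diameter (U i))"
      by auto
  qed auto
  finally show "hausdorff1_pre \<delta> A + hausdorff1_pre \<delta> B \<le> (\<Sum>i. ennreal (diameter (U i)))" .
qed

text \<open>Since \<open>hausdorff1_pre\<close> grows as the scale shrinks, its supremum is its
  limit from the right at scale 0, and the inequality valid at all scales below \<open>d\<close>
  passes to the limit.\<close>

lemma hausdorff1_outer_separated:
  assumes d: "\<And>x y. x \<in> A \<Longrightarrow> y \<in> B \<Longrightarrow> d \<le> dist x y" and "0 < d"
  shows "hausdorff1_outer (A \<union> B) = hausdorff1_outer A + hausdorff1_outer B"
proof (rule antisym[OF hausdorff1_outer_Un_le])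
  have lim: "((\<lambda>\<delta>. hausdorff1_pre \<delta> S) \<longlongrightarrow> hausdorff1_outer S) (at_right 0)" for S :: "'a set"
  proof (rule order_tendstoI)
    fix a assume "a < hausdorff1_outer S"
    then obtain e where e: "0 < e" "a < hausdorff1_pre e S"
      unfolding hausdorff1_outer_def less_SUP_iff by auto
    show "\<forall>\<^sub>F \<delta> in at_right 0. a < hausdorff1_pre \<delta> S"
      unfolding eventually_at_right_field
      using e hausdorff1_pre_antimono[of _ e S] by (intro exI[of _ e]) (auto intro: less_le_trans)
  next
    fix a assume a: "hausdorff1_outer S < a"
    show "\<forall>\<^sub>F \<delta> in at_right 0. hausdorff1_pre \<delta> S < a"
      unfolding eventually_at_right_field
      using a hausdorff1_pre_le_outer[of _ S] by (intro exI[of _ 1]) (auto intro: le_less_trans)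
  qed
  show "hausdorff1_outer A + hausdorff1_outer B \<le> hausdorff1_outer (A \<union> B)"
  proof (rule tendsto_le[OF _ lim tendsto_add[OF lim lim]])
    show "\<forall>\<^sub>F \<delta> in at_right 0. hausdorff1_pre \<delta> A + hausdorff1_pre \<delta> B \<le> hausdorff1_pre \<delta> (A \<union> B)"
      unfolding eventually_at_right_field using hausdorff1_pre_separated[OF d] \<open>0 < d\<close>
      by (intro exI[of _ d]) auto
  qed auto
qed


text \<open>Caratheodory's criterion for metric outer measures. \<open>E - C\<close> need not have
  positive distance from \<open>C\<close>, so additivity is applied to the parts \<open>S n\<close>
  at distance at least 1/(n+1). What they miss lies in the shells \<open>R n\<close>, and the
  measures of the shells form a convergent series, so the tail is negligible.\<close>

lemma hausdorff1_outer_closed_split: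
  fixes C :: "'a::metric_space set"
  assumes "closed C"
  shows "hausdorff1_outer E = hausdorff1_outer (E \<inter> C) + hausdorff1_outer (E - C)"
\<comment> \<open>By convention \<open>infdist\<close> to the empty set is 0, so distances say
  nothing in that case. Finiteness of the measure of \<open>E\<close> is what makes the series over
  the shells converge.\<close>
proof (cases "C = {} \<or> hausdorff1_outer E = top")
  case True
  then show ?thesis
  proof
    assume E: "hausdorff1_outer E = top"
    have "E = (E \<inter> C) \<union> (E - C)" by blast
    then have "hausdorff1_outer E \<le> hausdorff1_outer (E \<inter> C) + hausdorff1_outer (E - C)"
      using hausdorff1_outer_Un_le[of "E \<inter> C" "E - C"] by simp
    then have "hausdorff1_outer (E \<inter> C) + hausdorff1_outer (E - C) = top"
      using E by (simp only: top_unique)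
    then show ?thesis using E by (simp only:)
  qed (simp add: hausdorff1_outer_empty)
next
  case False
  then have "C \<noteq> {}" and fin: "hausdorff1_outer E < top" by (auto simp: top.not_eq_extremum)
  let ?H = "hausdorff1_outer :: 'a set \<Rightarrow> ennreal"
  define R where "R n = {x \<in> E. 1 / (real n + 2) \<le> infdist x C \<and> infdist x C < 1 / (real n + 1)}" for n
  define S where "S n = {x \<in> E. 1 / (real n + 1) \<le> infdist x C}" for n
  have dist: "infdist x C - infdist y C \<le> dist x y" for x y
    using infdist_triangle[of x C y] by simp
  have inv: "0 < 1 / x - 1 / (x + 1)" if "0 < x" for x :: real
    using that by (auto simp: field_simps intro: add_pos_pos)
  \<comment> \<open>Neighbouring shells touch, but two shells with indices of equal parity are
    separated by the shell between them. Here \<open>p\<close> is the parity; the even and the odd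
    sums are each bounded by the measure of \<open>E\<close>.\<close>
  have odd_even: "(\<Sum>k<m. ?H (R (2 * k + p))) \<le> ?H E" for m p
  proof -
    have "(\<Sum>k<m. ?H (R (2 * k + p))) = ?H (\<Union>k<m. R (2 * k + p))"
    proof (induction m)
      case 0
      then show ?case by (simp add: hausdorff1_outer_empty)
    next
      case (Suc m)
      show ?case
      \<comment> \<open>The gap below has the denominator 2m + p, which must not vanish; for
        \<open>m = 0\<close> the union is empty.\<close>
      proof (cases "m = 0")
        case False
        have sep: "1 / (real (2 * m + p)) - 1 / (real (2 * m + p) + 1) \<le> dist x y"
          if x: "x \<in> (\<Union>k<m. R (2 * k + p))" and y: "y \<in> R (2 * m + p)" for x y
        proof -
          obtain k where k: "k < m" "x \<in> R (2 * k + p)" using x by blast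
          then have "1 / (real (2 * m + p)) \<le> 1 / (real (2 * k + p) + 2)"
            by (intro divide_left_mono) auto
          also have "\<dots> \<le> infdist x C" using k by (simp add: R_def)
          finally have "1 / (real (2 * m + p)) - 1 / (real (2 * m + p) + 1) \<le> infdist x C - infdist y C"
            using y unfolding R_def by simp
          then show ?thesis using dist[of x y] by simp
        qed
        have "?H ((\<Union>k<m. R (2 * k + p)) \<union> R (2 * m + p)) = ?H (\<Union>k<m. R (2 * k + p)) + ?H (R (2 * m + p))"
          by (rule hausdorff1_outer_separated[OF sep], assumption, assumption, rule inv) (use False in simp)
        then show ?thesis using Suc by (simp add: lessThan_Suc Un_commute add.commute)
      qed (simp add: lessThan_Suc)
    qed
    also have "\<dots> \<le> ?H E" by (rule hausdorff1_outer_mono) (auto simp: R_def)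
    finally show ?thesis .
  qed
  have "(\<Sum>n<m. ?H (R n)) \<le> ?H E + ?H E" for m
  proof -
    have "(\<Sum>n<m. ?H (R n)) \<le> (\<Sum>n<2 * m. ?H (R n))" by (rule sum_mono2) auto
    also have "\<dots> = (\<Sum>k<m. ?H (R (2 * k + 0))) + (\<Sum>k<m. ?H (R (2 * k + 1)))"
      by (induction m) (auto simp: algebra_simps)
    also have "\<dots> \<le> ?H E + ?H E" by (intro add_mono odd_even)
    finally show ?thesis .
  qed
  then have "(\<Sum>n. ?H (R n)) \<le> ?H E + ?H E"
    by (intro suminf_le_const) (auto intro: summableI)
  then have sfin: "(\<Sum>n. ?H (R n)) < top" using fin by (auto intro: le_less_trans)
  then have Rfin: "?H (R n) < top" for n using ennreal_suminf_lessD by blast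
  have r: "?H (R n) = ennreal (enn2real (?H (R n)))" for n using Rfin[of n] by simp
  have summ: "summable (\<lambda>n. enn2real (?H (R n)))"
    by (rule summable_suminf_not_top) (use sfin r in auto)
  show ?thesis
  proof (rule antisym)
    have "E = (E \<inter> C) \<union> (E - C)" by blast
    then show "?H E \<le> ?H (E \<inter> C) + ?H (E - C)"
      using hausdorff1_outer_Un_le[of "E \<inter> C" "E - C"] by simp
    show "?H (E \<inter> C) + ?H (E - C) \<le> ?H E"
    proof (rule ennreal_le_epsilon)
      fix e :: real assume "0 < e"
      then obtain N where N: "norm (\<Sum>i. enn2real (?H (R (i + N)))) < e"
        using suminf_exist_split[OF _ summ] by blast
      have "(\<Sum>i. ?H (R (i + N))) = (\<Sum>i. ennreal (enn2real (?H (R (i + N)))))" using r by simp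
      also have "\<dots> = ennreal (\<Sum>i. enn2real (?H (R (i + N))))"
        by (rule suminf_ennreal2) (use summ in \<open>auto simp: summable_iff_shift[of "\<lambda>n. enn2real (?H (R n))"]\<close>)
      also have "\<dots> \<le> ennreal e" using N by (intro ennreal_leI) auto
      finally have tail: "(\<Sum>i. ?H (R (i + N))) \<le> ennreal e" .
      have "E - C \<subseteq> S N \<union> (\<Union>i. R (i + N))"
      proof
        fix x assume x: "x \<in> E - C"
        then have pos: "0 < infdist x C"
          using in_closed_iff_infdist_zero[OF \<open>closed C\<close> \<open>C \<noteq> {}\<close>, of x] infdist_nonneg[of x C] by force
        show "x \<in> S N \<union> (\<Union>i. R (i + N))"
        proof (cases "1 / (real N + 1) \<le> infdist x C")
          case False
          \<comment> \<open>\<open>x\<close> is closer to \<open>C\<close> than 1/(N+1). If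
            \<open>k\<close> is the first index whose threshold 1/(k+1) it reaches, then it lies in
            the shell with index k - 1, and k > N.\<close>
          define P where "P n \<longleftrightarrow> 1 / (real n + 1) \<le> infdist x C" for n
          obtain n where "inverse (real (Suc n)) < infdist x C"
            using pos reals_Archimedean by blast
          then have "P n" by (simp add: P_def inverse_eq_divide add.commute)
          define k where "k = (LEAST n. P n)"
          have k: "P k" "\<And>j. j < k \<Longrightarrow> \<not> P j"
            unfolding k_def using \<open>P n\<close> by (auto intro: LeastI dest: not_less_Least)
          have "N < k"
          proof (rule ccontr)
            assume "\<not> N < k"
            then have "1 / (real N + 1) \<le> 1 / (real k + 1)" by (intro divide_left_mono) auto
            then show False using k(1) False by (simp add: P_def)
          qed
          have "\<not> P (k - 1)" using k(2) \<open>N < k\<close> by simp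
          then have "x \<in> R ((k - 1 - N) + N)"
            using k(1) \<open>N < k\<close> x by (auto simp: R_def P_def of_nat_diff add.commute)
          then show ?thesis by blast
        qed (use x in \<open>simp add: S_def\<close>)
      qed
      then have "?H (E - C) \<le> ?H (S N \<union> (\<Union>i. R (i + N)))" by (rule hausdorff1_outer_mono)
      also have "\<dots> \<le> ?H (S N) + ?H (\<Union>i. R (i + N))" by (rule hausdorff1_outer_Un_le)
      also have "\<dots> \<le> ?H (S N) + ennreal e"
        using hausdorff1_outer_Union_le[of "\<lambda>i. R (i + N)"] tail by (intro add_left_mono) (rule order_trans)
      finally have 1: "?H (E - C) \<le> ?H (S N) + ennreal e" .
      have sep: "1 / (real N + 1) \<le> dist x y" if "x \<in> S N" "y \<in> E \<inter> C" for x y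
        using that infdist_le[of y C x] by (auto simp: S_def)
      have "?H (S N \<union> (E \<inter> C)) = ?H (S N) + ?H (E \<inter> C)"
        by (rule hausdorff1_outer_separated[OF sep]) auto
      moreover have "?H (S N \<union> (E \<inter> C)) \<le> ?H E" by (rule hausdorff1_outer_mono) (auto simp: S_def)
      ultimately have "?H (E \<inter> C) + (?H (S N) + ennreal e) \<le> ?H E + ennreal e"
        by (metis add.assoc add.commute add_right_mono)
      then show "?H (E \<inter> C) + ?H (E - C) \<le> ?H E + ennreal e"
        using 1 by (metis add_left_mono order_trans)
    qed
  qed
qed

lemma sets_hausdorff1 [simp, measurable_cong]: "sets hausdorff1 = sets borel"
  and space_hausdorff1 [simp]: "space hausdorff1 = UNIV"
  unfolding hausdorff1_def
  by (metis sets.sets_measure_of_eq space_borel, metis space_measure_of_conv)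

text \<open>The sets satisfying the Caratheodory condition form a sigma-algebra on which the outer
  measure is countably additive. It contains the closed sets, hence the Borel sets, so
  \<open>measure_of\<close> keeps the given values.\<close>

lemma emeasure_hausdorff1:
  fixes A :: "'a::metric_space set"
  assumes "A \<in> sets borel"
  shows "emeasure hausdorff1 A = hausdorff1_outer A"
proof -
  let ?L = "lambda_system UNIV (Pow UNIV) (hausdorff1_outer :: 'a set \<Rightarrow> ennreal)"
  interpret P: sigma_algebra "UNIV :: 'a set" "Pow UNIV" by (rule sigma_algebra_Pow)
  have L: "measure_space UNIV ?L hausdorff1_outer"
    by (rule P.caratheodory_lemma[OF outer_measure_space_hausdorff1])
  then interpret L: sigma_algebra UNIV ?L by (simp add: measure_space_def)
  have "C \<in> ?L" if "closed C" for C
    unfolding P.lambda_system_eq using hausdorff1_outer_closed_split[OF that, symmetric] by simp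
  then have "sigma_sets UNIV (Collect closed) \<subseteq> ?L" by (intro L.sigma_sets_subset) auto
  then have sub: "sets borel \<subseteq> ?L" by (simp add: borel_eq_closed)
  show ?thesis
  proof (rule emeasure_measure_of[OF hausdorff1_def])
    show "positive (sets hausdorff1) (hausdorff1_outer :: 'a set \<Rightarrow> ennreal)"
      by (simp add: positive_def hausdorff1_outer_empty)
    have "countably_additive ?L hausdorff1_outer" using L by (simp add: measure_space_def)
    then show "countably_additive (sets hausdorff1) (hausdorff1_outer :: 'a set \<Rightarrow> ennreal)"
      using sub unfolding countably_additive_def by (simp add: subset_iff)
  qed (use assms in auto)
qed

section \<open>Slicing a domain by lines\<close>

text \<open>The endpoints lie in the frontier of \<open>U\<close> itself because the frontier of a
  component is contained in the frontier of the whole set.\<close>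

lemma bounded_open_component_real:
  fixes U :: "real set"
  assumes "open U" "bounded U" "c \<in> components U"
  obtains a b where "a < b" "c = {a<..<b}" "a \<in> frontier U" "b \<in> frontier U"
proof -
  have c: "open c" "connected c" "c \<noteq> {}" "bounded c"
    by (rule open_components[OF assms(1,3)], rule in_components_connected[OF assms(3)],
        rule in_components_nonempty[OF assms(3)],
        rule bounded_subset[OF assms(2) in_components_subset[OF assms(3)]])
  have bb: "bdd_below c" "bdd_above c" using c(4) bounded_imp_bdd_below bounded_imp_bdd_above by auto
  have lim: "Inf c < x \<and> x < Sup c" if x: "x \<in> c" for x
  proof -
    obtain d where d: "d > 0" "ball x d \<subseteq> c" using openE[OF c(1) x] by blast
    have "x - d/2 \<in> c" "x + d/2 \<in> c" using d by (auto intro!: subsetD[OF d(2)] simp: dist_real_def)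
    then have "Inf c \<le> x - d/2" "x + d/2 \<le> Sup c" using bb by (auto intro: cInf_lower cSup_upper)
    then show ?thesis using d by auto
  qed
  have eq: "c = {Inf c<..<Sup c}"
  proof
    show "{Inf c<..<Sup c} \<subseteq> c"
    proof
      fix x assume "x \<in> {Inf c<..<Sup c}"
      then obtain y z where "y \<in> c" "y < x" "z \<in> c" "x < z"
        using bb c(3) by (auto simp: cInf_less_iff less_cSup_iff)
      then show "x \<in> c" using c(2) by (meson connected_iff_interval less_imp_le)
    qed
  qed (use lim in auto)
  have lt: "Inf c < Sup c" using c(3) lim by (meson ex_in_conv less_trans)
  have "frontier c \<subseteq> frontier U" using assms(3) by (rule frontier_of_components_subset)
  moreover have "frontier c = {Inf c, Sup c}"
  proof -
    have "frontier {Inf c<..<Sup c} = {Inf c, Sup c}"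
      using lt by (auto simp: frontier_def)
    then show ?thesis using eq by simp
  qed
  ultimately show ?thesis using that[OF lt eq] by auto
qed

lemma integral_deriv_open_interval:
  fixes f f' :: "real \<Rightarrow> real"
  assumes "a < b" and "\<And>t. (f has_real_derivative f' t) (at t)" and "continuous_on UNIV f'"
  shows "(LINT t|lborel. indicator {a<..<b} t * f' t) = f b - f a"
proof -
  have [measurable]: "f' \<in> borel_measurable borel" using assms(3) by (rule borel_measurable_continuous_onI)
  have "(LINT t|lborel. indicator {a<..<b} t * f' t) = (LINT t|lborel. indicator {a..b} t *\<^sub>R f' t)"
  proof (rule integral_cong_AE)
    have "AE t in lborel. t \<noteq> a \<and> t \<noteq> b"
      using AE_lborel_singleton[of a] AE_lborel_singleton[of b] by auto
    then show "AE t in lborel. indicator {a<..<b} t * f' t = indicator {a..b} t *\<^sub>R f' t"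
      by eventually_elim (auto simp: indicator_def)
  qed measurable
  also have "\<dots> = f b - f a"
    using assms by (intro integral_FTC_atLeastAtMost)
      (auto simp: has_real_derivative_iff_has_vector_derivative[symmetric] intro: has_field_derivative_at_within continuous_on_subset)
  finally show ?thesis .
qed

lemma integrable_lborel_continuous_bounded:
  fixes f :: "'a::euclidean_space \<Rightarrow> real"
  assumes "continuous_on UNIV f" "bounded S" "S \<in> sets borel"
  shows "integrable lborel (\<lambda>x. indicator S x * f x)"
proof -
  obtain a b where ab: "S \<subseteq> cbox a b" using \<open>bounded S\<close> bounded_subset_cbox_symmetric by blast
  have [measurable]: "f \<in> borel_measurable borel" using assms(1) by (rule borel_measurable_continuous_onI)
  have "integrable lborel (\<lambda>x. indicator (cbox a b) x *\<^sub>R f x)"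
    by (rule borel_integrable_compact[OF compact_cbox continuous_on_subset[OF assms(1)]]) simp
  then show ?thesis
    by (rule Bochner_Integration.integrable_bound) (use assms(3) ab in \<open>auto simp: indicator_def\<close>)
qed

text \<open>On each component interval the integral is a difference of endpoint values. A frontier
  point is the left end of at most one component and the right end of at most one, whence the factor
  2. The frontier may be uncountable, so \<open>N\<close> is required to bound finite sums only;
  countably many components are reached by dominated convergence.\<close>

lemma abs_integral_deriv_le_frontier:
  fixes f f' :: "real \<Rightarrow> real"
  assumes U: "open U" "bounded U"
    and f: "\<And>t. (f has_real_derivative f' t) (at t)" and f': "continuous_on UNIV f'"
    and N: "\<And>P. finite P \<Longrightarrow> P \<subseteq> frontier U \<Longrightarrow> (\<Sum>p\<in>P. ennreal \<bar>f p\<bar>) \<le> N"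
  shows "ennreal \<bar>LINT t|lborel. indicator U t * f' t\<bar> \<le> 2 * N"
proof (cases "U = {}")
  case False
  let ?J = "\<lambda>c. LINT t|lborel. indicator c t * f' t"
  have [measurable]: "f' \<in> borel_measurable borel" using f' by (rule borel_measurable_continuous_onI)
  have [measurable]: "U \<in> sets borel" using U(1) by (rule borel_open)
  have fin: "ennreal \<bar>?J (\<Union>C)\<bar> \<le> 2 * N" if C: "finite C" "C \<subseteq> components U" for C
  proof -
    have cU: "open c" "bounded c" if "c \<in> C" for c
      using that C(2) open_components[OF U(1)] in_components_subset bounded_subset[OF U(2)] by (blast, meson subsetD)
    have "\<forall>c\<in>C. \<exists>a b. a < b \<and> c = {a<..<b} \<and> a \<in> frontier U \<and> b \<in> frontier U"
    proof
      fix c assume "c \<in> C"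
      then have "c \<in> components U" using C(2) by blast
      from bounded_open_component_real[OF U this]
      show "\<exists>a b. a < b \<and> c = {a<..<b} \<and> a \<in> frontier U \<and> b \<in> frontier U" by blast
    qed
    then obtain a b :: "real set \<Rightarrow> real" where ab: "\<And>c. c \<in> C \<Longrightarrow> a c < b c" "\<And>c. c \<in> C \<Longrightarrow> c = {a c<..<b c}"
      "\<And>c. c \<in> C \<Longrightarrow> a c \<in> frontier U" "\<And>c. c \<in> C \<Longrightarrow> b c \<in> frontier U" by metis
    have disj: "c \<inter> d = {}" if "c \<in> C" "d \<in> C" "c \<noteq> d" for c d
      using that C(2) components_nonoverlap[of c U d] by blast
    have inj: "inj_on a C" "inj_on b C"
    proof -
      have "c = d" if cd: "c \<in> C" "d \<in> C" "a c = a d \<or> b c = b d" for c d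
      proof (rule ccontr)
        assume "c \<noteq> d"
        then have dis: "{a c<..<b c} \<inter> {a d<..<b d} = {}" 
            using disj[OF cd(1,2)] ab(2)[OF cd(1)] ab(2)[OF cd(2)] by simp
        \<comment> \<open>Two open intervals with a common left end, or a common right end, overlap;
          this is the midpoint of their intersection.\<close>
        have "(max (a c) (a d) + min (b c) (b d)) / 2 \<in> {a c<..<b c} \<inter> {a d<..<b d}"
          using ab(1)[OF cd(1)] ab(1)[OF cd(2)] cd(3) by (auto simp: max_def min_def)
        then show False using dis by blast
      qed
      then show "inj_on a C" "inj_on b C" by (auto intro!: inj_onI)
    qed
    have ind: "indicator (\<Union>C) t * f' t = (\<Sum>c\<in>C. indicator c t * f' t)" for t
    proof -
      have "indicator (\<Union>c\<in>C. c) t = (\<Sum>c\<in>C. indicator c t :: real)"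
        by (rule indicator_UN_disjoint) (use C disj in \<open>auto simp: disjoint_family_on_def\<close>)
      then show ?thesis by (simp add: sum_distrib_right)
    qed
    have "?J (\<Union>C) = (\<Sum>c\<in>C. ?J c)"
      unfolding ind
      by (intro Bochner_Integration.integral_sum integrable_lborel_continuous_bounded[OF f'] cU borel_open)
    also have "\<dots> = (\<Sum>c\<in>C. f (b c) - f (a c))"
    proof (rule sum.cong[OF refl])
      fix c assume "c \<in> C"
      then show "?J c = f (b c) - f (a c)"
        using integral_deriv_open_interval[OF ab(1) f f'] ab(2)[symmetric] by simp
    qed
    finally have "\<bar>?J (\<Union>C)\<bar> \<le> (\<Sum>c\<in>C. \<bar>f (b c)\<bar> + \<bar>f (a c)\<bar>)"
      by (auto intro!: order_trans[OF sum_abs] sum_mono)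
    then have "ennreal \<bar>?J (\<Union>C)\<bar> \<le> ennreal (\<Sum>c\<in>C. \<bar>f (b c)\<bar> + \<bar>f (a c)\<bar>)" by (rule ennreal_leI)
    also have "\<dots> = (\<Sum>c\<in>C. ennreal \<bar>f (b c)\<bar>) + (\<Sum>c\<in>C. ennreal \<bar>f (a c)\<bar>)"
      by (simp add: sum.distrib sum_ennreal[symmetric] del: sum_ennreal)
    also have "\<dots> = (\<Sum>p\<in>b ` C. ennreal \<bar>f p\<bar>) + (\<Sum>p\<in>a ` C. ennreal \<bar>f p\<bar>)"
      using inj by (simp add: sum.reindex)
    also have "\<dots> \<le> N + N" using C ab by (intro add_mono N) auto
    finally show ?thesis by (simp add: mult_2)
  qed
  have cnt: "countable (components U)"
    by (rule countable_disjoint_open_subsets) (use U pairwise_disjoint_components open_components in \<open>auto simp: disjoint_def pairwise_def disjnt_def\<close>)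
  have ne: "components U \<noteq> {}" using False by simp
  \<comment> \<open>\<open>from_nat_into\<close> repeats values if there are finitely many
    components; since \<open>C n\<close> is a set, no component is counted twice.\<close>
  define C where "C n = from_nat_into (components U) ` {..<n}" for n
  have C: "finite (C n)" "C n \<subseteq> components U" for n
    using from_nat_into[OF ne] by (auto simp: C_def)
  have CU: "\<Union>(C n) \<subseteq> U" for n using C(2)[of n] in_components_subset by blast
  have "(\<lambda>n. ?J (\<Union>(C n))) \<longlonglongrightarrow> ?J U"
  proof (rule integral_dominated_convergence[where w = "\<lambda>t. indicator U t * \<bar>f' t\<bar>"])
    show "integrable lborel (\<lambda>t. indicator U t * \<bar>f' t\<bar>)"
      by (rule integrable_lborel_continuous_bounded) (use U f' in \<open>auto intro: continuous_intros\<close>)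
    show "AE t in lborel. (\<lambda>n. indicator (\<Union>(C n)) t * f' t) \<longlonglongrightarrow> indicator U t * f' t"
    proof (rule AE_I2, rule tendsto_mult[OF _ tendsto_const], rule tendsto_eventually)
      fix t
      show "\<forall>\<^sub>F n in sequentially. indicator (\<Union>(C n)) t = (indicator U t :: real)"
      proof (cases "t \<in> U")
        case True
        then obtain c where c: "c \<in> components U" "t \<in> c" using Union_components[of U] by blast
        obtain m where "from_nat_into (components U) m = c"
          using from_nat_into_surj[OF cnt c(1)] by blast
        then have "t \<in> \<Union>(C n)" if "n > m" for n using that c by (auto simp: C_def)
        then show ?thesis using True unfolding eventually_sequentially
          by (intro exI[of _ "Suc m"]) auto
      next
        case False
        then have "t \<notin> \<Union>(C n)" for n using CU by blast
        then show ?thesis using False by simp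
      qed
    qed
    show "AE t in lborel. norm (indicator (\<Union>(C n)) t * f' t) \<le> indicator U t * \<bar>f' t\<bar>" for n
      using CU[of n] by (auto simp: indicator_def)
    have "\<Union>(C n) \<in> sets borel" for n
      using C(2) open_components U(1) by (intro borel_open open_Union) blast
    then show "(\<lambda>t. indicator (\<Union>(C n)) t * f' t) \<in> borel_measurable lborel" for n by measurable
    show "(\<lambda>t. indicator U t * f' t) \<in> borel_measurable lborel" by measurable
  qed
  then have "(\<lambda>n. ennreal \<bar>?J (\<Union>(C n))\<bar>) \<longlonglongrightarrow> ennreal \<bar>?J U\<bar>"
    by (intro tendsto_ennrealI tendsto_rabs)
  then show ?thesis by (rule Lim_bounded) (use fin[OF C] in auto)
qed simp

text \<open>A coordinate is 1-Lipschitz, so the image of each covering set fits into an interval no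
  longer than its diameter; scale 1 suffices. A non-measurable image has \<open>emeasure\<close> 0,
  so \<open>A\<close> may be arbitrary.\<close>

lemma emeasure_component_image_le_hausdorff1:
  fixes A :: "(real^'n) set"
  shows "emeasure lborel ((\<lambda>x. x $ j) ` A) \<le> hausdorff1_outer A"
proof -
  let ?p = "\<lambda>x::real^'n. x $ j"
  have "emeasure lborel (?p ` A) \<le> hausdorff1_pre 1 A"
    unfolding hausdorff1_pre_def
  proof (rule INF_greatest)
    fix U :: "nat \<Rightarrow> (real^'n) set"
    assume "U \<in> {U. (\<forall>i. bounded (U i) \<and> diameter (U i) \<le> 1) \<and> A \<subseteq> (\<Union>i. U i)}"
    then have U: "\<And>n. bounded (U n)" "A \<subseteq> (\<Union>n. U n)" by auto
    \<comment> \<open>\<open>Inf\<close> and \<open>Sup\<close> of the empty set are unspecified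
      reals, so an empty covering set needs its own value.\<close>
    define I where "I n = (if U n = {} then {} else {Inf (?p ` U n)..Sup (?p ` U n)})" for n
    have I: "?p ` U n \<subseteq> I n" "emeasure lborel (I n) \<le> ennreal (diameter (U n))" for n
    proof -
      have *: "x $ j - y $ j \<le> diameter (U n)" if "x \<in> U n" "y \<in> U n" for x y
        using diameter_bounded_bound[OF U(1) that] component_le_norm_cart[of "x - y" j]
        by (simp add: dist_norm)
      have "bounded (?p ` U n)" using U(1) by (rule bounded_component_cart)
      then show "?p ` U n \<subseteq> I n"
        using bounded_imp_bdd_below bounded_imp_bdd_above
        by (auto simp: I_def intro!: cInf_lower cSup_upper)
      show "emeasure lborel (I n) \<le> ennreal (diameter (U n))"
      proof (cases "U n = {}")
        case False
        have "x $ j - diameter (U n) \<le> Inf (?p ` U n)" if "x \<in> U n" for x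
          using False *[OF that] by (intro cINF_greatest) (auto simp: algebra_simps)
        then have "x $ j \<le> Inf (?p ` U n) + diameter (U n)" if "x \<in> U n" for x
          using that by (simp add: algebra_simps)
        then have "Sup (?p ` U n) \<le> Inf (?p ` U n) + diameter (U n)"
          using False by (intro cSUP_least) auto
        then show ?thesis using False by (auto simp: I_def emeasure_lborel_Icc_eq intro!: ennreal_leI)
      qed (simp add: I_def)
    qed
    have [measurable]: "I n \<in> sets borel" for n by (simp add: I_def)
    have "?p ` A \<subseteq> (\<Union>n. I n)"
    proof (rule image_subsetI)
      fix x assume "x \<in> A"
      then obtain n where "x \<in> U n" using U(2) by (meson UN_E subsetD)
      then show "x $ j \<in> (\<Union>n. I n)" by (intro UN_I[of n] subsetD[OF I(1)] imageI) auto
    qed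
    then have "emeasure lborel (?p ` A) \<le> emeasure lborel (\<Union>n. I n)"
      by (rule emeasure_mono) measurable
    also have "\<dots> \<le> (\<Sum>n. emeasure lborel (I n))"
      by (rule emeasure_subadditive_countably) (simp add: image_subset_iff)
    also have "\<dots> \<le> (\<Sum>n. ennreal (diameter (U n)))" by (intro suminf_le I) auto
    finally show "emeasure lborel (?p ` A) \<le> (\<Sum>n. ennreal (diameter (U n)))" .
  qed
  then show ?thesis using hausdorff1_pre_le_outer[of 1 A] by (auto intro: order_trans)
qed

text \<open>The transversal coordinate comes first, so that in the iterated integral of Fubini's
  theorem the inner variable runs along the line in direction \<open>i\<close>.\<close>

definition slice_map :: "2 \<Rightarrow> 2 \<Rightarrow> real \<times> real \<Rightarrow> real^2" where
  "slice_map i j p = snd p *\<^sub>R axis i 1 + fst p *\<^sub>R axis j 1"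

lemma UNIV_2_neq: "i \<noteq> j \<Longrightarrow> UNIV = {i, j :: 2}"
  using exhaust_2[of i] exhaust_2[of j] by (auto simp: UNIV_2)

lemma slice_map_nth:
  assumes "i \<noteq> j"
  shows "slice_map i j p $ i = snd p" "slice_map i j p $ j = fst p"
  using assms by (auto simp: slice_map_def axis_def)

text \<open>Lebesgue measure is determined by its values on boxes, and a box pulls back to a product
  of two intervals with the same side lengths.\<close>

lemma lborel_slice_map:
  assumes ij: "i \<noteq> j"
  shows "distr (lborel \<Otimes>\<^sub>M lborel) borel (slice_map i j) = lborel"
proof (rule lborel_eqI[symmetric])
  have [measurable]: "slice_map i j \<in> borel_measurable (lborel \<Otimes>\<^sub>M lborel)"
    unfolding slice_map_def by measurable
  fix l u :: "real^2"
  assume le: "\<And>b. b \<in> Basis \<Longrightarrow> l \<bullet> b \<le> u \<bullet> b"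
  have B: "Basis = {axis i 1, axis j 1 :: real^2}"
    using UNIV_2_neq[OF ij] by (auto simp: Basis_vec_def)
  have lij: "l $ i \<le> u $ i" "l $ j \<le> u $ j"
    using le[of "axis i 1"] le[of "axis j 1"] by (auto simp: B inner_axis)
  have ax: "axis i 1 \<noteq> (axis j 1 :: real^2)" using ij by (simp add: axis_eq_axis)
  have "slice_map i j -` box l u \<inter> space (lborel \<Otimes>\<^sub>M lborel) = {l $ j<..<u $ j} \<times> {l $ i<..<u $ i}"
    using slice_map_nth[OF ij] by (auto simp: box_def B space_pair_measure inner_axis)
  then have "emeasure (distr (lborel \<Otimes>\<^sub>M lborel) borel (slice_map i j)) (box l u)
      = emeasure (lborel \<Otimes>\<^sub>M lborel) ({l $ j<..<u $ j} \<times> {l $ i<..<u $ i})"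
    by (subst emeasure_distr) auto
  also have "\<dots> = ennreal (u $ j - l $ j) * ennreal (u $ i - l $ i)"
    using lij by (subst lborel.emeasure_pair_measure_Times) auto
  also have "\<dots> = ennreal (\<Prod>b\<in>Basis. (u - l) \<bullet> b)"
    using lij ax by (simp add: B inner_axis ennreal_mult mult.commute inner_diff_left)
  finally show "emeasure (distr (lborel \<Otimes>\<^sub>M lborel) borel (slice_map i j)) (box l u)
      = ennreal (\<Prod>b\<in>Basis. (u - l) \<bullet> b)" .
qed simp

lemma integral_slices:
  fixes f :: "real^2 \<Rightarrow> real"
  assumes ij: "i \<noteq> j" and f: "integrable lborel f"
  shows "(LINT x|lborel. f x) = (LINT y|lborel. LINT t|lborel. f (slice_map i j (y, t)))"
    and "integrable lborel (\<lambda>y. LINT t|lborel. f (slice_map i j (y, t)))"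
proof -
  have s[measurable]: "slice_map i j \<in> borel_measurable (lborel \<Otimes>\<^sub>M lborel)"
    unfolding slice_map_def by measurable
  have [measurable]: "f \<in> borel_measurable borel" using f by auto
  have d: "integrable (distr (lborel \<Otimes>\<^sub>M lborel) borel (slice_map i j)) f"
    using f unfolding lborel_slice_map[OF ij] .
  have int: "integrable (lborel \<Otimes>\<^sub>M lborel) (\<lambda>p. f (slice_map i j p))"
    by (rule integrable_distr[OF s d])
  have "(LINT x|lborel. f x) = (LINT x|distr (lborel \<Otimes>\<^sub>M lborel) borel (slice_map i j). f x)"
    by (simp only: lborel_slice_map[OF ij])
  also have "\<dots> = (LINT p|(lborel \<Otimes>\<^sub>M lborel). f (slice_map i j p))" by (rule integral_distr) auto
  finally show "(LINT x|lborel. f x) = (LINT y|lborel. LINT t|lborel. f (slice_map i j (y, t)))"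
    using lborel_pair.integral_fst'[OF int] by simp
  show "integrable lborel (\<lambda>y. LINT t|lborel. f (slice_map i j (y, t)))"
    using lborel_pair.integrable_fst'[OF int] .
qed

text \<open>Projections of Borel sets need not be Borel. Here the open set is a countable union of
  closed boxes, each of which cuts a compact piece out of \<open>K\<close>, so the image is a
  countable union of compact sets.\<close>

lemma component_image_Int_borel:
  fixes K :: "(real^'n) set"
  assumes "compact K" "open U"
  shows "(\<lambda>x. x $ j) ` (K \<inter> U) \<in> sets borel"
proof -
  obtain D where D: "countable D" "\<And>X. X \<in> D \<Longrightarrow> \<exists>a b. X = cbox a b" "\<Union>D = U"
    using open_countable_Union_open_cbox[OF assms(2)] by metis
  have "(\<lambda>x. x $ j) ` (K \<inter> U) = (\<Union>X\<in>D. (\<lambda>x. x $ j) ` (K \<inter> X))" using D(3) by blast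
  moreover have "compact ((\<lambda>x. x $ j) ` (K \<inter> X))" if "X \<in> D" for X
  proof -
    have "compact (K \<inter> X)" using D(2)[OF that] assms(1) by (auto intro: compact_Int)
    then show ?thesis by (intro compact_continuous_image continuous_intros)
  qed
  ultimately show ?thesis using D(1) by (simp only:) (rule sets.countable_UN'', auto intro: borel_compact)
qed


section \<open>Boundary points on a line and the dyadic grid\<close>

lemma frontier_slice:
  assumes "open \<omega>" "t \<in> frontier {t. slice_map i j (y, t) \<in> \<omega>}"
  shows "slice_map i j (y, t) \<in> frontier \<omega>"
proof -
  let ?s = "\<lambda>t. slice_map i j (y, t)"
  have c: "continuous_on UNIV ?s"
    unfolding slice_map_def by (intro continuous_intros)
  then have "open (?s -` \<omega>)" using assms(1) by (simp add: open_vimage)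
  then have "?s t \<notin> \<omega>" using assms(2) by (simp add: frontier_def interior_open vimage_def)
  moreover have "closed (?s -` closure \<omega>)" using c by (simp add: closed_vimage)
  then have "closure (?s -` \<omega>) \<subseteq> ?s -` closure \<omega>"
    by (rule closure_minimal[rotated]) (use closure_subset in auto)
  then have "?s t \<in> closure \<omega>" using assms(2) by (auto simp: frontier_def vimage_def)
  ultimately show ?thesis using assms(1) by (simp add: frontier_def interior_open)
qed

text \<open>The level sets are half-open dyadic squares of side 2^-k. Half-open squares partition
  the plane, so each boundary point is counted in exactly one of them.\<close>

definition grid_cell :: "nat \<Rightarrow> 2 \<Rightarrow> 2 \<Rightarrow> real^2 \<Rightarrow> int \<times> int" where
  "grid_cell k i j x = (\<lfloor>2^k * x $ i\<rfloor>, \<lfloor>2^k * x $ j\<rfloor>)"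

lemma dist_grid_cell:
  assumes "i \<noteq> j" "grid_cell k i j x = grid_cell k i j z"
  shows "dist x z \<le> 2 * (1/2)^k"
proof -
  have fl: "\<bar>a - b\<bar> \<le> (1/2)^k" if "\<lfloor>2^k * a\<rfloor> = \<lfloor>2^k * b\<rfloor>" for a b :: real
  proof -
    have "\<bar>2^k * a - 2^k * b\<bar> < 1" using that by linarith
    then have "2^k * \<bar>a - b\<bar> < 1" by (simp add: right_diff_distrib[symmetric] abs_mult)
    then show ?thesis by (simp add: field_simps power_one_over)
  qed
  have "dist x z \<le> (\<Sum>l\<in>UNIV. \<bar>(x - z) $ l\<bar>)" unfolding dist_norm by (rule norm_le_l1_cart)
  also have "\<dots> = \<bar>x $ i - z $ i\<bar> + \<bar>x $ j - z $ j\<bar>"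
    using assms(1) by (simp add: UNIV_2_neq[OF assms(1)])
  also have "\<dots> \<le> (1/2)^k + (1/2)^k"
    using assms(2) by (intro add_mono fl) (auto simp: grid_cell_def)
  finally show ?thesis by simp
qed

lemma finite_grid_cell_image:
  assumes "bounded S"
  shows "finite (grid_cell k i j ` S)"
proof -
  obtain B where B: "\<And>x. x \<in> S \<Longrightarrow> norm x \<le> B" using assms bounded_iff by blast
  let ?I = "{\<lfloor>- (2^k * B)\<rfloor>..\<lfloor>2^k * B\<rfloor>}"
  have "\<lfloor>2^k * x $ l\<rfloor> \<in> ?I" if "x \<in> S" for x l
  proof -
    have "\<bar>x $ l\<bar> \<le> B" using component_le_norm_cart[of x l] B[OF that] by linarith
    then have "\<bar>2^k * x $ l\<bar> \<le> 2^k * B" by (simp add: abs_mult)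
    then show ?thesis by (auto simp: abs_le_iff intro!: floor_mono)
  qed
  then have "grid_cell k i j ` S \<subseteq> ?I \<times> ?I" by (auto simp: grid_cell_def)
  then show ?thesis by (rule finite_subset) auto
qed

text \<open>A half-open square is neither open nor closed; this is the splitting that
  \<open>component_image_Int_borel\<close> asks for.\<close>

lemma grid_cell_vimage_eq:
  fixes i j :: 2
  obtains C U :: "(real^2) set" where "closed C" "open U" "grid_cell k i j -` {c} = C \<inter> U"
proof
  let ?C = "{x::real^2. of_int (fst c) \<le> 2^k * x $ i} \<inter> {x. of_int (snd c) \<le> 2^k * x $ j}"
  let ?U = "{x::real^2. 2^k * x $ i < of_int (fst c) + 1} \<inter> {x. 2^k * x $ j < of_int (snd c) + 1}"
  show "closed ?C" by (intro closed_Int closed_Collect_le continuous_intros)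
  show "open ?U" by (intro open_Int open_Collect_less continuous_intros)
  show "grid_cell k i j -` {c} = ?C \<inter> ?U"
    by (cases c) (auto simp: grid_cell_def floor_eq_iff)
qed

text \<open>The integral along a line in direction \<open>i\<close> is controlled by the values of \<open>F\<close> at the
  points where the line meets the boundary. To integrate the sum of these values over all lines
  without discussing its measurability, it is approximated from below by sums over the cells of
  a grid; each cell contributes the length of the projection of a piece of the boundary, which is
  at most the Hausdorff measure of that piece.\<close>

lemma abs_integral_partial_le_boundary:
  fixes F D :: "real^2 \<Rightarrow> real"
  assumes ij: "i \<noteq> j" and \<omega>: "open \<omega>" "bounded \<omega>"
    and D: "continuous_on UNIV D" and F: "continuous_on UNIV F"
    and deriv: "\<And>x. ((\<lambda>t. F (x + t *\<^sub>R axis i 1)) has_real_derivative D x) (at 0)"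
  shows "ennreal \<bar>LINT x|lborel. indicator \<omega> x * D x\<bar>
    \<le> 2 * (\<integral>\<^sup>+x. ennreal \<bar>F x\<bar> \<partial>boundary_measure \<omega>)"
proof -
  let ?s = "slice_map i j"
  define A where "A k c = frontier \<omega> \<inter> grid_cell k i j -` {c}" for k c
  define m where "m k c = (INF x\<in>A k c. ennreal \<bar>F x\<bar>)" for k c
  \<comment> \<open>A Borel function of \<open>y\<close> that bounds from below the sum of |F| over
    the boundary points on the line: a cell contributes the infimum of |F| on its piece of the
    boundary if the line meets that piece.\<close>
  define N where "N k y = (\<Sum>c\<in>grid_cell k i j ` frontier \<omega>. m k c * indicator ((\<lambda>x. x $ j) ` A k c) y)" for k y
  have cfr: "compact (frontier \<omega>)" using \<omega>(2) by (rule compact_frontier_bounded)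
  then have fr: "bounded (frontier \<omega>)" by (rule compact_imp_bounded)
  have fin: "finite (grid_cell k i j ` frontier \<omega>)" for k by (rule finite_grid_cell_image[OF fr])
  have A: "A k c \<in> sets borel" "(\<lambda>x. x $ j) ` A k c \<in> sets borel" for k c
  proof -
    obtain C U where CU: "closed C" "open U" "grid_cell k i j -` {c} = C \<inter> U"
      by (rule grid_cell_vimage_eq)
    have eq: "A k c = (frontier \<omega> \<inter> C) \<inter> U" using CU(3) by (auto simp: A_def)
    have K: "compact (frontier \<omega> \<inter> C)" using cfr CU(1) by (rule compact_Int_closed)
    show "A k c \<in> sets borel" unfolding eq using K CU(2) by (intro sets.Int borel_compact borel_open)
    show "(\<lambda>x. x $ j) ` A k c \<in> sets borel"
      unfolding eq by (rule component_image_Int_borel[OF K CU(2)])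
  qed
  have Nmeas: "N k \<in> borel_measurable lborel" for k
    unfolding N_def using A(2) by measurable
  have F_borel: "(\<lambda>x. ennreal \<bar>F x\<bar>) \<in> borel_measurable borel"
    using F by (intro measurable_compose[OF borel_measurable_continuous_onI measurable_ennreal] continuous_intros)
  let ?I = "\<integral>\<^sup>+x. ennreal \<bar>F x\<bar> \<partial>boundary_measure \<omega>"
  have I: "?I = (\<integral>\<^sup>+x. ennreal \<bar>F x\<bar> * indicator (frontier \<omega>) x \<partial>hausdorff1)"
    unfolding boundary_measure_def by (rule nn_integral_restrict_space) simp
  have int_N: "(\<integral>\<^sup>+y. N k y \<partial>lborel) \<le> ?I" for k
  proof -
    have "(\<integral>\<^sup>+y. N k y \<partial>lborel)
        = (\<Sum>c\<in>grid_cell k i j ` frontier \<omega>. m k c * emeasure lborel ((\<lambda>x. x $ j) ` A k c))"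
      unfolding N_def using A(2) by (subst nn_integral_sum) (auto simp: nn_integral_cmult_indicator)
    also have "\<dots> \<le> (\<Sum>c\<in>grid_cell k i j ` frontier \<omega>. m k c * emeasure hausdorff1 (A k c))"
      using emeasure_component_image_le_hausdorff1[of j] A(1)
      by (intro sum_mono mult_left_mono) (auto simp: emeasure_hausdorff1)
    also have "\<dots> = (\<integral>\<^sup>+x. (\<Sum>c\<in>grid_cell k i j ` frontier \<omega>. m k c * indicator (A k c) x) \<partial>hausdorff1)"
      using A(1) by (subst nn_integral_sum) (auto simp: nn_integral_cmult_indicator)
    also have "\<dots> \<le> (\<integral>\<^sup>+x. ennreal \<bar>F x\<bar> * indicator (frontier \<omega>) x \<partial>hausdorff1)"
    proof (rule nn_integral_mono)
      fix x :: "real^2"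
      show "(\<Sum>c\<in>grid_cell k i j ` frontier \<omega>. m k c * indicator (A k c) x)
          \<le> ennreal \<bar>F x\<bar> * indicator (frontier \<omega>) x"
      proof (cases "x \<in> frontier \<omega>")
        case True
        let ?c = "grid_cell k i j x"
        have "(\<Sum>c\<in>grid_cell k i j ` frontier \<omega>. m k c * indicator (A k c) x)
            = (\<Sum>c\<in>{?c}. m k c * indicator (A k c) x)"
          by (rule sum.mono_neutral_right[OF fin]) (use True in \<open>auto simp: A_def indicator_def\<close>)
        also have "\<dots> \<le> ennreal \<bar>F x\<bar>"
          using True by (auto simp: A_def m_def intro: INF_lower)
        finally show ?thesis using True by simp
      qed (simp add: A_def)
    qed
    finally show ?thesis unfolding I .
  qed
  let ?U = "\<lambda>y. {t. ?s (y, t) \<in> \<omega>}"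
  let ?J = "\<lambda>y. LINT t|lborel. indicator \<omega> (?s (y, t)) * D (?s (y, t))"
  have slice: "ennreal \<bar>?J y\<bar> \<le> 2 * liminf (\<lambda>k. N k y)" for y
  proof -
    have cs: "continuous_on UNIV (\<lambda>t. ?s (y, t))"
      unfolding slice_map_def by (intro continuous_intros)
    have "open ((\<lambda>t. ?s (y, t)) -` \<omega>)" using cs \<omega>(1) by (simp add: open_vimage)
    then have oU: "open (?U y)" by (simp add: vimage_def)
    obtain B where B: "\<And>x. x \<in> \<omega> \<Longrightarrow> norm x \<le> B" using \<omega>(2) bounded_iff by blast
    have "norm t \<le> B" if "t \<in> ?U y" for t
      using that B[of "?s (y, t)"] component_le_norm_cart[of "?s (y, t)" i] slice_map_nth[OF ij, of "(y, t)"] by auto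
    then have bU: "bounded (?U y)" unfolding bounded_iff by blast
    have df: "((\<lambda>t. F (?s (y, t))) has_real_derivative D (?s (y, t))) (at t)" for t
    proof -
      have "?s (y, h + t) = ?s (y, t) + h *\<^sub>R axis i 1" for h
        by (simp add: slice_map_def algebra_simps)
      then have "((\<lambda>h. F (?s (y, h + t))) has_real_derivative D (?s (y, t))) (at 0)"
        using deriv[of "?s (y, t)"] by simp
      then show ?thesis
        using DERIV_shift[of "\<lambda>t. F (?s (y, t))" "D (?s (y, t))" 0 t] by simp
    qed
    have "ennreal \<bar>LINT t|lborel. indicator (?U y) t * D (?s (y, t))\<bar> \<le> 2 * liminf (\<lambda>k. N k y)"
    proof (rule abs_integral_deriv_le_frontier[OF oU bU df])
      show "continuous_on UNIV (\<lambda>t. D (?s (y, t)))"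
        by (rule continuous_on_compose2[OF D cs]) simp
      fix P :: "real set" assume P: "finite P" "P \<subseteq> frontier (?U y)"
      have Pfr: "?s (y, t) \<in> frontier \<omega>" if "t \<in> P" for t
        using frontier_slice[OF \<omega>(1)] P(2) that by blast
      \<comment> \<open>On a fine grid, continuity keeps |F| within \<open>d\<close> of its value at
        a point of \<open>P\<close> throughout the cell of that point. \<open>ennreal\<close> cuts
        negative differences off at 0, which only lowers the left side.\<close>
      have approx: "(\<Sum>t\<in>P. ennreal (\<bar>F (?s (y, t))\<bar> - d)) \<le> liminf (\<lambda>k. N k y)" if d: "0 < d" for d
      proof (rule Liminf_bounded)
        have small: "\<forall>\<^sub>F k in sequentially. 2 * (1/2::real)^k < e" if "0 < e" for e
        proof -
          have "(\<lambda>k. 2 * (1/2::real)^k) \<longlonglongrightarrow> 2 * 0"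
            by (intro tendsto_mult tendsto_const LIMSEQ_power_zero) simp
          then show ?thesis using that by (intro order_tendstoD) auto
        qed
        have 1: "\<forall>\<^sub>F k in sequentially. \<forall>t\<in>P. ennreal (\<bar>F (?s (y, t))\<bar> - d) \<le> m k (grid_cell k i j (?s (y, t)))"
        proof (rule eventually_ball_finite[OF P(1)], rule ballI)
          fix t assume "t \<in> P"
          have "isCont F (?s (y, t))" using F by (simp add: continuous_on_eq_continuous_at)
          then obtain e where e: "e > 0" "\<And>x. dist x (?s (y, t)) < e \<Longrightarrow> dist (F x) (F (?s (y, t))) < d"
            using d unfolding continuous_at_eps_delta by blast
          show "\<forall>\<^sub>F k in sequentially. ennreal (\<bar>F (?s (y, t))\<bar> - d) \<le> m k (grid_cell k i j (?s (y, t)))"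
            using small[OF e(1)]
          proof eventually_elim
            case (elim k)
            show ?case unfolding m_def
            proof (rule INF_greatest)
              fix x assume "x \<in> A k (grid_cell k i j (?s (y, t)))"
              then have "dist x (?s (y, t)) < e"
                using dist_grid_cell[OF ij, of k x "?s (y, t)"] elim by (simp add: A_def)
              then have "\<bar>F (?s (y, t))\<bar> - d \<le> \<bar>F x\<bar>"
                using e(2)[of x] unfolding dist_real_def by linarith
              then show "ennreal (\<bar>F (?s (y, t))\<bar> - d) \<le> ennreal \<bar>F x\<bar>" by (rule ennreal_leI)
            qed
          qed
        qed
        \<comment> \<open>Distinct points of \<open>P\<close> eventually lie in distinct cells, so
          the sum over \<open>P\<close> becomes part of the sum over cells.\<close>
        have 2: "\<forall>\<^sub>F k in sequentially. \<forall>t\<in>P. \<forall>u\<in>P. t \<noteq> u \<longrightarrow> grid_cell k i j (?s (y, t)) \<noteq> grid_cell k i j (?s (y, u))"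
        proof (intro eventually_ball_finite[OF P(1)] ballI)
          fix t u assume "t \<in> P" "u \<in> P"
          show "\<forall>\<^sub>F k in sequentially. t \<noteq> u \<longrightarrow> grid_cell k i j (?s (y, t)) \<noteq> grid_cell k i j (?s (y, u))"
          proof (cases "t = u")
            case False
            have "dist (?s (y, t)) (?s (y, u)) \<noteq> 0"
              using False slice_map_nth[OF ij, of "(y, t)"] slice_map_nth[OF ij, of "(y, u)"] by auto
            then have "0 < dist (?s (y, t)) (?s (y, u))" by simp
            from small[OF this] show ?thesis
              by eventually_elim (use dist_grid_cell[OF ij] in fastforce)
          qed simp
        qed
        show "\<forall>\<^sub>F k in sequentially. (\<Sum>t\<in>P. ennreal (\<bar>F (?s (y, t))\<bar> - d)) \<le> N k y"
          using 1 2
        proof eventually_elim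
          case (elim k)
          let ?c = "\<lambda>t. grid_cell k i j (?s (y, t))"
          have inj: "inj_on ?c P" using elim(2) by (auto intro!: inj_onI)
          have ind: "indicator ((\<lambda>x. x $ j) ` A k (?c t)) y = (1::ennreal)" if "t \<in> P" for t
          proof -
            have "?s (y, t) \<in> A k (?c t)" using Pfr[OF that] by (simp add: A_def)
            then have "?s (y, t) $ j \<in> (\<lambda>x. x $ j) ` A k (?c t)" by (rule imageI)
            then show ?thesis using slice_map_nth[OF ij, of "(y, t)"] by simp
          qed
          have "(\<Sum>t\<in>P. ennreal (\<bar>F (?s (y, t))\<bar> - d)) \<le> (\<Sum>t\<in>P. m k (?c t))"
            by (rule sum_mono) (use elim(1) in blast)
          also have "\<dots> = (\<Sum>t\<in>P. m k (?c t) * indicator ((\<lambda>x. x $ j) ` A k (?c t)) y)"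
            by (rule sum.cong) (simp_all add: ind)
          also have "\<dots> = (\<Sum>c\<in>?c ` P. m k c * indicator ((\<lambda>x. x $ j) ` A k c) y)"
            using inj by (simp add: sum.reindex)
          also have "\<dots> \<le> N k y"
            unfolding N_def by (rule sum_mono2[OF fin]) (use Pfr in auto)
          finally show ?case .
        qed
      qed
      show "(\<Sum>t\<in>P. ennreal \<bar>F (?s (y, t))\<bar>) \<le> liminf (\<lambda>k. N k y)"
      proof (rule ennreal_le_epsilon)
        fix e :: real assume "0 < e"
        \<comment> \<open>Each point of \<open>P\<close> loses \<open>d\<close>; the summand 1 keeps
          the denominator positive when \<open>P\<close> is empty.\<close>
        define d where "d = e / (real (card P) + 1)"
        have "0 < d" using \<open>0 < e\<close> by (simp add: d_def)
        have "(\<Sum>t\<in>P. ennreal \<bar>F (?s (y, t))\<bar>) \<le> (\<Sum>t\<in>P. ennreal (\<bar>F (?s (y, t))\<bar> - d) + ennreal d)"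
        proof (rule sum_mono)
          fix t
          have "ennreal \<bar>F (?s (y, t))\<bar> \<le> ennreal (max 0 (\<bar>F (?s (y, t))\<bar> - d) + d)"
            by (rule ennreal_leI) auto
          also have "\<dots> = ennreal (max 0 (\<bar>F (?s (y, t))\<bar> - d)) + ennreal d"
            using \<open>0 < d\<close> by (intro ennreal_plus) auto
          also have "ennreal (max 0 (\<bar>F (?s (y, t))\<bar> - d)) = ennreal (\<bar>F (?s (y, t))\<bar> - d)"
            by (simp add: max_def ennreal_neg)
          finally show "ennreal \<bar>F (?s (y, t))\<bar> \<le> ennreal (\<bar>F (?s (y, t))\<bar> - d) + ennreal d" .
        qed
        also have "\<dots> = (\<Sum>t\<in>P. ennreal (\<bar>F (?s (y, t))\<bar> - d)) + of_nat (card P) * ennreal d"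
          by (simp add: sum.distrib)
        also have "of_nat (card P) * ennreal d = ennreal (real (card P) * d)"
          using \<open>0 < d\<close> by (simp add: ennreal_mult ennreal_of_nat_eq_real_of_nat)
        also have "(\<Sum>t\<in>P. ennreal (\<bar>F (?s (y, t))\<bar> - d)) + ennreal (real (card P) * d) \<le> liminf (\<lambda>k. N k y) + ennreal e"
        proof (intro add_mono approx[OF \<open>0 < d\<close>] ennreal_leI)
          show "real (card P) * d \<le> e" using \<open>0 < e\<close> by (simp add: d_def field_simps)
        qed
        finally show "(\<Sum>t\<in>P. ennreal \<bar>F (?s (y, t))\<bar>) \<le> liminf (\<lambda>k. N k y) + ennreal e" .
      qed
    qed
    then show ?thesis by (simp add: indicator_def)
  qed
  have int: "integrable lborel (\<lambda>x. indicator \<omega> x * D x)"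
    by (rule integrable_lborel_continuous_bounded[OF D \<omega>(2)]) (use \<omega>(1) in simp)
  have "ennreal \<bar>LINT x|lborel. indicator \<omega> x * D x\<bar> = ennreal \<bar>LINT y|lborel. ?J y\<bar>"
    by (simp only: integral_slices(1)[OF ij int])
  also have "\<dots> \<le> (\<integral>\<^sup>+y. ennreal \<bar>?J y\<bar> \<partial>lborel)"
    using integral_norm_bound_ennreal[OF integral_slices(2)[OF ij int]] by simp
  also have "\<dots> \<le> (\<integral>\<^sup>+y. 2 * liminf (\<lambda>k. N k y) \<partial>lborel)" by (intro nn_integral_mono slice)
  also have "\<dots> = 2 * (\<integral>\<^sup>+y. liminf (\<lambda>k. N k y) \<partial>lborel)"
    by (rule nn_integral_cmult) (use Nmeas in measurable)
  \<comment> \<open>Fatou's lemma: only the functions \<open>N k\<close> have to be measurable, not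
    the sum over all boundary points on a line.\<close>
  also have "\<dots> \<le> 2 * liminf (\<lambda>k. \<integral>\<^sup>+y. N k y \<partial>lborel)"
    by (intro mult_left_mono nn_integral_liminf Nmeas) simp
  also have "\<dots> \<le> 2 * ?I"
  proof (rule mult_left_mono)
    have "liminf (\<lambda>k. \<integral>\<^sup>+y. N k y \<partial>lborel) \<le> liminf (\<lambda>k::nat. ?I)"
      by (rule Liminf_mono) (simp add: int_N)
    then show "liminf (\<lambda>k. \<integral>\<^sup>+y. N k y \<partial>lborel) \<le> ?I" by (simp add: Liminf_const)
  qed simp
  finally show ?thesis .
qed

section \<open>Smooth bump functions and weak derivatives\<close>

lemma has_derivative_partial_deriv:
  "(f has_derivative f') (at x) \<Longrightarrow> partial_deriv i f x = f' (axis i 1)"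
  unfolding partial_deriv_def using frechet_derivative_at by metis

lemma Ck_differentiable: "Ck (Suc k) f \<Longrightarrow> f differentiable (at x)"
  by simp

lemma Ck_SucD: "Ck (Suc k) f \<Longrightarrow> Ck k f"
proof (induction k arbitrary: f)
  case 0
  then show ?case
    by (auto simp: continuous_on_eq_continuous_at intro: differentiable_imp_continuous_within)
qed simp

lemma Ck_const: "Ck k (\<lambda>_ :: real^'n. c)"
proof (induction k arbitrary: c)
  case (Suc k)
  have "partial_deriv i (\<lambda>_ :: real^'n. c) = (\<lambda>_. 0)" for i
    by (rule ext, rule has_derivative_partial_deriv[OF has_derivative_const])
  then show ?case using Suc by simp
qed simp

lemma partial_deriv_add:
  fixes f g :: "real^'n \<Rightarrow> real"
  assumes "f differentiable (at x)" "g differentiable (at x)"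
  shows "partial_deriv i (\<lambda>x. f x + g x) x = partial_deriv i f x + partial_deriv i g x"
proof -
  obtain f' g' where "(f has_derivative f') (at x)" "(g has_derivative g') (at x)"
    using assms unfolding differentiable_def by blast
  then show ?thesis
    using has_derivative_partial_deriv[OF has_derivative_add, of f f' x g g' i]
    by (simp add: has_derivative_partial_deriv)
qed

lemma partial_deriv_mult:
  fixes f g :: "real^'n \<Rightarrow> real"
  assumes "f differentiable (at x)" "g differentiable (at x)"
  shows "partial_deriv i (\<lambda>x. f x * g x) x = f x * partial_deriv i g x + partial_deriv i f x * g x"
proof -
  obtain f' g' where "(f has_derivative f') (at x)" "(g has_derivative g') (at x)"
    using assms unfolding differentiable_def by blast
  then show ?thesis
    using has_derivative_partial_deriv[OF has_derivative_mult, of f f' x g g' i]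
    by (simp add: has_derivative_partial_deriv)
qed

lemma Ck_add: "Ck k f \<Longrightarrow> Ck k g \<Longrightarrow> Ck k (\<lambda>x. f x + g x)"
proof (induction k arbitrary: f g)
  case 0
  then show ?case by (simp add: continuous_on_add)
next
  case (Suc k)
  have "partial_deriv i (\<lambda>x. f x + g x) = (\<lambda>x. partial_deriv i f x + partial_deriv i g x)" for i
    using Suc.prems by (intro ext partial_deriv_add) auto
  then show ?case using Suc by simp
qed

lemma Ck_mult: "Ck k f \<Longrightarrow> Ck k g \<Longrightarrow> Ck k (\<lambda>x. f x * g x)"
proof (induction k arbitrary: f g)
  case 0
  then show ?case by (simp add: continuous_on_mult)
next
  case (Suc k)
  have "partial_deriv i (\<lambda>x. f x * g x) = (\<lambda>x. f x * partial_deriv i g x + partial_deriv i f x * g x)" for i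
    using Suc.prems by (intro ext partial_deriv_mult) auto
  moreover have "Ck k f" "Ck k g" using Suc.prems Ck_SucD by blast+
  ultimately show ?case using Suc by (simp add: Ck_add)
qed

lemma smooth_mult: "smooth f \<Longrightarrow> smooth g \<Longrightarrow> smooth (\<lambda>x. f x * g x)"
  by (simp add: smooth_def Ck_mult)

lemma smooth_prod: "finite S \<Longrightarrow> (\<And>s. s \<in> S \<Longrightarrow> smooth (f s)) \<Longrightarrow> smooth (\<lambda>x. \<Prod>s\<in>S. f s x)"
  by (induction S rule: finite_induct) (auto simp: smooth_mult, simp add: smooth_def Ck_const)

lemma smooth_differentiable: "smooth f \<Longrightarrow> f differentiable (at x)"
  unfolding smooth_def using Ck_differentiable by blast

lemma smooth_continuous: "smooth f \<Longrightarrow> continuous_on UNIV f"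
  unfolding smooth_def using Ck.simps(1) by blast

lemma smooth_partial_deriv: "smooth f \<Longrightarrow> smooth (partial_deriv i f)"
  unfolding smooth_def using Ck.simps(2) by blast

text \<open>The powers of \<open>t\<close> in the denominator make the family closed under differentiation.\<close>

definition flat_exp :: "real \<Rightarrow> nat \<Rightarrow> real \<Rightarrow> real" where
  "flat_exp c m t = (if 0 < t then exp (- c / t) / t ^ m else 0)"

text \<open>With s = c/t the function equals s^m / exp s up to the factor c^-m, and s tends to
  infinity as t decreases to 0.\<close>

lemma flat_exp_at_right:
  assumes "0 < c"
  shows "((\<lambda>t. flat_exp c m t) \<longlongrightarrow> 0) (at_right 0)"
proof -
  have "filterlim (\<lambda>t. c * inverse t) at_top (at_right 0)"
    by (rule filterlim_tendsto_pos_mult_at_top[OF tendsto_const assms filterlim_inverse_at_top_right])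
  then have "((\<lambda>t. (c * inverse t) ^ m / exp (c * inverse t)) \<longlongrightarrow> 0) (at_right 0)"
    by (rule filterlim_compose[OF tendsto_power_div_exp_0])
  then have "((\<lambda>t. inverse (c ^ m) * ((c * inverse t) ^ m / exp (c * inverse t))) \<longlongrightarrow> inverse (c ^ m) * 0) (at_right 0)"
    by (intro tendsto_mult tendsto_const)
  moreover have "\<forall>\<^sub>F t in at_right 0. inverse (c ^ m) * ((c * inverse t) ^ m / exp (c * inverse t)) = flat_exp c m t"
    unfolding eventually_at_right_field using assms
    by (auto simp: flat_exp_def field_simps exp_minus power_mult_distrib power_inverse intro!: exI[of _ 1])
  ultimately show ?thesis using Lim_transform_eventually by fastforce
qed

lemma DERIV_flat_exp:
  assumes c: "0 < c"
  shows "(flat_exp c m has_real_derivative c * flat_exp c (m + 2) t - real m * flat_exp c (m + 1) t) (at t)"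
proof (cases t "0 :: real" rule: linorder_cases)
  case less
  have "((\<lambda>_. 0) has_real_derivative 0) (at t)" by simp
  moreover have "\<forall>\<^sub>F x in nhds t. (\<lambda>_. 0) x = flat_exp c m x"
    using less eventually_nhds_in_open[of "{..<0}" t] by (auto elim!: eventually_mono simp: flat_exp_def)
  ultimately have "(flat_exp c m has_real_derivative 0) (at t)"
    using DERIV_cong_ev[of t t "\<lambda>_. 0" "flat_exp c m" 0 0] by simp
  then show ?thesis using less by (simp add: flat_exp_def)
next
  case greater
  have "((\<lambda>t. exp (- c / t) / t ^ m) has_real_derivative
      c * (exp (- c / t) / t ^ (m + 2)) - real m * (exp (- c / t) / t ^ (m + 1))) (at t)"
  \<comment> \<open>\<open>DERIV_pow\<close> involves the exponent m - 1 with truncated subtraction,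
    so m = 0 is treated apart.\<close>
  proof (cases m)
    case (Suc n)
    have "((\<lambda>t. t ^ m) has_real_derivative real m * t ^ n) (at t)"
      using DERIV_pow[of m t] Suc by simp
    moreover have "((\<lambda>t. exp (- c / t)) has_real_derivative exp (- c / t) * (c / t\<^sup>2)) (at t)"
      using greater by (auto intro!: derivative_eq_intros simp: field_simps power2_eq_square)
    ultimately have "((\<lambda>t. exp (- c / t) / t ^ m) has_real_derivative
        (exp (- c / t) * (c / t\<^sup>2) * t ^ m - exp (- c / t) * (real m * t ^ n)) / (t ^ m * t ^ m)) (at t)"
      using greater by (intro DERIV_divide) auto
    then show ?thesis
      by (rule DERIV_cong) (use greater Suc in \<open>simp add: field_simps power2_eq_square\<close>)
  qed (use greater in \<open>auto intro!: derivative_eq_intros simp: field_simps power2_eq_square\<close>)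
  moreover have "\<forall>\<^sub>F x in nhds t. exp (- c / x) / x ^ m = flat_exp c m x"
    using greater eventually_nhds_in_open[of "{0<..}" t] by (auto elim!: eventually_mono simp: flat_exp_def)
  ultimately show ?thesis
    using greater DERIV_cong_ev[of t t "\<lambda>t. exp (- c / t) / t ^ m" "flat_exp c m"] by (simp add: flat_exp_def)
next
  \<comment> \<open>Dividing by h only raises the exponent m by one, so the quotient from the right
    is again a member of the family and tends to 0; from the left it is identically 0.\<close>
  case equal
  have "((\<lambda>h. (flat_exp c m (0 + h) - flat_exp c m 0) / h) \<longlongrightarrow> 0) (at 0)"
    unfolding filterlim_at_split
  proof
    have "\<forall>\<^sub>F h in at_left 0. (0::real) = (flat_exp c m (0 + h) - flat_exp c m 0) / h"
      by (auto simp: eventually_at_left_field flat_exp_def intro!: exI[of _ "-1"])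
    then show "((\<lambda>h. (flat_exp c m (0 + h) - flat_exp c m 0) / h) \<longlongrightarrow> 0) (at_left 0)"
      by (rule Lim_transform_eventually[OF tendsto_const])
    have "\<forall>\<^sub>F h in at_right 0. flat_exp c (m + 1) h = (flat_exp c m (0 + h) - flat_exp c m 0) / h"
      by (auto simp: eventually_at_right_field flat_exp_def intro!: exI[of _ 1])
    then show "((\<lambda>h. (flat_exp c m (0 + h) - flat_exp c m 0) / h) \<longlongrightarrow> 0) (at_right 0)"
      by (rule Lim_transform_eventually[OF flat_exp_at_right[OF c]])
  qed
  then show ?thesis using equal by (simp add: DERIV_def flat_exp_def)
qed

lemma partial_deriv_compose_component:
  fixes x :: "real^'n"
  assumes "(p has_real_derivative p') (at (s * x $ i + d))"
  shows "((\<lambda>x. p (s * x $ i + d)) has_derivative (\<lambda>h. p' * (s * h $ i))) (at x)"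
    and "partial_deriv j (\<lambda>x. p (s * x $ i + d)) x = (if i = j then p' * s else 0)"
proof -
  have "((\<lambda>x::real^'n. s * x $ i + d) has_derivative (\<lambda>h. s * h $ i)) (at x)"
    by (auto intro!: derivative_eq_intros bounded_linear_imp_has_derivative bounded_linear_vec_nth)
  from has_derivative_compose[OF this assms[unfolded has_field_derivative_def]]
  show 1: "((\<lambda>x. p (s * x $ i + d)) has_derivative (\<lambda>h. p' * (s * h $ i))) (at x)" .
  show "partial_deriv j (\<lambda>x. p (s * x $ i + d)) x = (if i = j then p' * s else 0)"
    using has_derivative_partial_deriv[OF 1] by (simp add: axis_def)
qed

text \<open>The affine argument covers both faces of a box in direction \<open>i\<close>:
  \<open>s = 1\<close> for the lower one and \<open>s = -1\<close> for the upper one.\<close>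

lemma smooth_flat_exp_component:
  assumes c: "0 < c"
  shows "smooth (\<lambda>x::real^'n. flat_exp c m (s * x $ i + d))"
  unfolding smooth_def
proof
  fix k
  show "Ck k (\<lambda>x::real^'n. flat_exp c m (s * x $ i + d))"
  proof (induction k arbitrary: m)
    case 0
    have "(\<lambda>x::real^'n. flat_exp c m (s * x $ i + d)) differentiable (at x)" for x
      using partial_deriv_compose_component(1)[OF DERIV_flat_exp[OF c]] differentiable_def by blast
    then show ?case
      by (auto simp: continuous_on_eq_continuous_at intro: differentiable_imp_continuous_within)
  next
    case (Suc k)
    have "partial_deriv j (\<lambda>x::real^'n. flat_exp c m (s * x $ i + d)) = (\<lambda>x.
        (if i = j then s * c else 0) * flat_exp c (m + 2) (s * x $ i + d)
        + (if i = j then - (s * real m) else 0) * flat_exp c (m + 1) (s * x $ i + d))" for j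
      by (rule ext, subst partial_deriv_compose_component(2)[OF DERIV_flat_exp[OF c]])
        (simp add: algebra_simps)
    then have "Ck k (partial_deriv j (\<lambda>x::real^'n. flat_exp c m (s * x $ i + d)))" for j
      by (simp only:) (intro Ck_add Ck_mult Ck_const Suc.IH)
    moreover have "(\<lambda>x::real^'n. flat_exp c m (s * x $ i + d)) differentiable (at x)" for x
      using partial_deriv_compose_component(1)[OF DERIV_flat_exp[OF c]] differentiable_def by blast
    ultimately show ?case by simp
  qed
qed

text \<open>The function exp(-1/((k+1) t)), extended by 0 to t <= 0, is smooth and tends to 1 for
  every t > 0; one such factor is taken for each face. The products are positive on all of the open
  box, so their supports fill the closed box, which therefore has to lie inside the domain when they
  serve as test functions.\<close>

lemma box_bump_functions:
  fixes a b :: "real^'n"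
  obtains \<phi> :: "nat \<Rightarrow> real^'n \<Rightarrow> real"
  where "\<And>k. smooth (\<phi> k)" "\<And>k x. 0 \<le> \<phi> k x \<and> \<phi> k x \<le> 1" "\<And>k x. x \<notin> box a b \<Longrightarrow> \<phi> k x = 0"
    "\<And>x. (\<lambda>k. \<phi> k x) \<longlonglongrightarrow> indicator (box a b) x"
proof
  define \<beta> where "\<beta> k t = flat_exp (1 / real (Suc k)) 0 t" for k t
  define \<phi> where "\<phi> k x = (\<Prod>i\<in>UNIV. \<beta> k (1 * x $ i + (- a $ i)) * \<beta> k ((- 1) * x $ i + b $ i))"
    for k and x :: "real^'n"
  have \<beta>: "0 \<le> \<beta> k t" "\<beta> k t \<le> 1" for k t by (auto simp: \<beta>_def flat_exp_def)
  show "smooth (\<phi> k)" for k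
    unfolding \<phi>_def[abs_def] \<beta>_def by (intro smooth_prod smooth_mult smooth_flat_exp_component) auto
  show "0 \<le> \<phi> k x \<and> \<phi> k x \<le> 1" for k x
    unfolding \<phi>_def using \<beta> by (auto intro!: prod_nonneg prod_le_1 mult_le_one)
  show zero: "\<phi> k x = 0" if "x \<notin> box a b" for k x
  proof -
    obtain i where i: "x $ i \<le> a $ i \<or> b $ i \<le> x $ i"
      using \<open>x \<notin> box a b\<close> unfolding mem_box_cart by (meson not_le)
    have "\<beta> k (1 * x $ i + (- a $ i)) * \<beta> k ((- 1) * x $ i + b $ i) = 0"
      using i by (auto simp: \<beta>_def flat_exp_def)
    then show ?thesis unfolding \<phi>_def by (intro prod_zero) auto
  qed
  show "(\<lambda>k. \<phi> k x) \<longlonglongrightarrow> indicator (box a b) x" for x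
  proof (cases "x \<in> box a b")
    case True
    have lim: "(\<lambda>k. \<beta> k t) \<longlonglongrightarrow> 1" if "0 < t" for t
    proof -
      have "(\<lambda>k. - (1 / real (Suc k)) / t) \<longlonglongrightarrow> - 0 / t"
        by (intro tendsto_divide tendsto_minus tendsto_const LIMSEQ_Suc[OF lim_1_over_n]) (use that in auto)
      then have "(\<lambda>k. exp (- (1 / real (Suc k)) / t)) \<longlonglongrightarrow> exp (- 0 / t)" by (rule tendsto_exp)
      then show ?thesis using that by (simp add: \<beta>_def[abs_def] flat_exp_def)
    qed
    have "(\<lambda>k. \<phi> k x) \<longlonglongrightarrow> (\<Prod>i\<in>(UNIV :: 'n set). 1 * 1)"
      unfolding \<phi>_def by (intro tendsto_prod tendsto_mult lim) (use True in \<open>auto simp: mem_box_cart\<close>)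
    then show ?thesis using True by simp
  qed (simp add: zero)
qed

section \<open>The fundamental lemma of the calculus of variations\<close>

lemma integral_lebesgue_on_subset:
  fixes f :: "'a::euclidean_space \<Rightarrow> real"
  assumes "K \<in> sets lebesgue" "S \<in> sets lebesgue" "K \<subseteq> S" "\<And>x. x \<in> S - K \<Longrightarrow> f x = 0"
  shows "(LINT x|lebesgue_on S. f x) = (LINT x|lebesgue_on K. f x)"
    and "integrable (lebesgue_on S) f \<longleftrightarrow> integrable (lebesgue_on K) f"
proof -
  have eq: "(\<lambda>x. indicator S x *\<^sub>R f x) = (\<lambda>x. indicator K x *\<^sub>R f x)"
  proof
    fix x show "indicator S x *\<^sub>R f x = indicator K x *\<^sub>R f x"
      using assms(3) assms(4)[of x] by (cases "x \<in> K"; cases "x \<in> S") auto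
  qed
  show "(LINT x|lebesgue_on S. f x) = (LINT x|lebesgue_on K. f x)"
    using assms(1,2) eq by (simp add: integral_restrict_space)
  show "integrable (lebesgue_on S) f \<longleftrightarrow> integrable (lebesgue_on K) f"
    using assms(1,2) eq by (simp add: integrable_restrict_space)
qed

lemma test_function_support:
  assumes "\<phi> \<in> test_functions \<omega>"
  shows "\<exists>K. compact K \<and> K \<subseteq> \<omega> \<and> (\<forall>x. x \<notin> K \<longrightarrow> \<phi> x = 0) \<and> (\<forall>x i. x \<notin> K \<longrightarrow> partial_deriv i \<phi> x = 0)"
proof (intro exI conjI allI impI)
  let ?K = "closure {x. \<phi> x \<noteq> 0}"
  show "compact ?K" "?K \<subseteq> \<omega>" using assms by (auto simp: test_functions_def)
  show z: "\<phi> x = 0" if "x \<notin> ?K" for x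
    using that closure_subset[of "{x. \<phi> x \<noteq> 0}"] by blast
  show "partial_deriv i \<phi> x = 0" if "x \<notin> ?K" for x i
  proof -
    have "(\<phi> has_derivative (\<lambda>_. 0)) (at x)"
    proof (rule has_derivative_transform_within_open[OF has_derivative_const])
      show "open (- ?K)" by (simp add: open_Compl)
      show "x \<in> - ?K" using that by blast
      show "0 = \<phi> y" if y: "y \<in> - ?K" for y using z[of y] y by simp
    qed
    then show ?thesis by (rule has_derivative_partial_deriv)
  qed
qed

lemma integrable_L1_loc_mult:
  assumes "open \<omega>" "f \<in> L1_loc \<omega>" "compact K" "K \<subseteq> \<omega>" "continuous_on UNIV g" "\<And>x. x \<notin> K \<Longrightarrow> g x = 0"
  shows "integrable (lebesgue_on \<omega>) (\<lambda>x. f x * g x)"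
proof -
  have K: "K \<in> sets lebesgue" using assms(3) by (simp add: compact_imp_closed lmeasurable_compact)
  have f: "integrable (lebesgue_on K) f" using assms(2-4) by (simp add: L1_loc_def)
  obtain B where B: "\<And>x. x \<in> K \<Longrightarrow> norm (g x) \<le> B"
    using compact_imp_bounded[OF compact_continuous_image[OF continuous_on_subset[OF assms(5)] assms(3)]]
    by (auto simp: bounded_iff)
  have g: "g \<in> borel_measurable (lebesgue_on K)"
    using assms(5) K by (intro continuous_imp_measurable_on_sets_lebesgue) (auto intro: continuous_on_subset)
  have "integrable (lebesgue_on K) (\<lambda>x. g x * f x)"
  proof (rule Bochner_Integration.integrable_bound[OF integrable_mult_right[OF f, of B]])
    show "(\<lambda>x. g x * f x) \<in> borel_measurable (lebesgue_on K)" using f g by measurable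
    show "AE x in lebesgue_on K. norm (g x * f x) \<le> norm (B * f x)"
    proof (rule AE_I2)
      fix x assume "x \<in> space (lebesgue_on K)"
      then have "norm (g x) \<le> \<bar>B\<bar>" using B[of x] by (auto simp: space_restrict_space)
      then show "norm (g x * f x) \<le> norm (B * f x)" by (auto simp: abs_mult intro: mult_right_mono)
    qed
  qed
  then show ?thesis
    using assms(1,4,6) K by (subst integral_lebesgue_on_subset(2)[of K]) (auto simp: mult.commute)
qed

text \<open>The bump functions of the box are admissible tests and converge boundedly to its
  indicator; \<open>L1_loc\<close> supplies the integrable majorant |h| on the compact box.\<close>

lemma integral_box_eq_0:
  fixes h :: "real^'n \<Rightarrow> real"
  assumes \<omega>: "open \<omega>" and h: "h \<in> L1_loc \<omega>"
    and test: "\<And>\<phi>. \<phi> \<in> test_functions \<omega> \<Longrightarrow> (LINT x|lebesgue_on \<omega>. h x * \<phi> x) = 0"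
    and ab: "cbox a b \<subseteq> \<omega>"
  shows "(LINT x|lebesgue. indicator (box a b) x * h x) = 0"
proof -
  obtain \<phi> :: "nat \<Rightarrow> real^'n \<Rightarrow> real"
    where \<phi>: "\<And>k. smooth (\<phi> k)" "\<And>k x. 0 \<le> \<phi> k x \<and> \<phi> k x \<le> 1" "\<And>k x. x \<notin> box a b \<Longrightarrow> \<phi> k x = 0"
      "\<And>x. (\<lambda>k. \<phi> k x) \<longlonglongrightarrow> indicator (box a b) x" using box_bump_functions[of a b] by metis
  have "closure {x. \<phi> k x \<noteq> 0} \<subseteq> cbox a b" for k
  proof (rule closure_minimal)
    show "{x. \<phi> k x \<noteq> 0} \<subseteq> cbox a b" using \<phi>(3)[of _ k] box_subset_cbox[of a b] by blast
  qed (rule closed_cbox)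
  then have "\<phi> k \<in> test_functions \<omega>" for k
    using \<phi>(1) ab bounded_subset[OF bounded_cbox] unfolding test_functions_def
    by (simp add: compact_eq_bounded_closed) blast
  then have "(LINT x|lebesgue_on \<omega>. h x * \<phi> k x) = 0" for k by (rule test)
  moreover have "(LINT x|lebesgue_on \<omega>. h x * \<phi> k x) = (LINT x|lebesgue_on (cbox a b). h x * \<phi> k x)" for k
  proof (rule integral_lebesgue_on_subset)
    show "h x * \<phi> k x = 0" if "x \<in> \<omega> - cbox a b" for x
      using that \<phi>(3)[of x k] box_subset_cbox[of a b] by auto
  qed (use \<omega> ab in auto)
  moreover have "(\<lambda>k. LINT x|lebesgue_on (cbox a b). h x * \<phi> k x)
      \<longlonglongrightarrow> (LINT x|lebesgue_on (cbox a b). h x * indicator (box a b) x)"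
  proof (rule integral_dominated_convergence[where w = "\<lambda>x. \<bar>h x\<bar>"])
    have int: "integrable (lebesgue_on (cbox a b)) h" using h ab by (simp add: L1_loc_def)
    then show "integrable (lebesgue_on (cbox a b)) (\<lambda>x. \<bar>h x\<bar>)" by simp
    have m: "(\<lambda>x. f x) \<in> borel_measurable (lebesgue_on (cbox a b))" if "f \<in> borel_measurable borel" for f :: "real^'n \<Rightarrow> real"
      using that by (intro measurable_restrict_space1 measurable_completion) simp
    show "(\<lambda>x. h x * indicator (box a b) x) \<in> borel_measurable (lebesgue_on (cbox a b))"
      by (intro borel_measurable_times borel_measurable_integrable[OF int] m) measurable
    show "(\<lambda>x. h x * \<phi> k x) \<in> borel_measurable (lebesgue_on (cbox a b))" for k
      by (intro borel_measurable_times borel_measurable_integrable[OF int] m borel_measurable_continuous_onI smooth_continuous \<phi>)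
    show "AE x in lebesgue_on (cbox a b). (\<lambda>k. h x * \<phi> k x) \<longlonglongrightarrow> h x * indicator (box a b) x"
      by (intro AE_I2 tendsto_mult tendsto_const \<phi>)
    show "AE x in lebesgue_on (cbox a b). norm (h x * \<phi> k x) \<le> \<bar>h x\<bar>" for k
      using \<phi>(2)[of k] by (intro AE_I2) (auto simp: abs_mult intro: mult_left_le)
  qed
  ultimately have "(LINT x|lebesgue_on (cbox a b). h x * indicator (box a b) x) = 0"
    using LIMSEQ_unique[OF tendsto_const] by fastforce
  also have "(LINT x|lebesgue_on (cbox a b). h x * indicator (box a b) x)
      = (LINT x|lebesgue. indicator (cbox a b) x *\<^sub>R (h x * indicator (box a b) x))"
    by (rule integral_restrict_space) simp
  also have "(\<lambda>x. indicator (cbox a b) x *\<^sub>R (h x * indicator (box a b) x)) = (\<lambda>x. indicator (box a b) x * h x)"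
  proof
    fix x show "indicator (cbox a b) x *\<^sub>R (h x * indicator (box a b) x) = indicator (box a b) x * h x"
      using box_subset_cbox[of a b] by (cases "x \<in> box a b"; cases "x \<in> cbox a b") auto
  qed
  finally show ?thesis .
qed


text \<open>Dynkin's pi-lambda argument: open boxes are stable under intersection and generate the
  Borel sets. The complement step needs the integral over the whole space, which is not a box;
  \<open>gS\<close> reduces it to the integral over one.\<close>

lemma AE_zero_of_integral_boxes:
  fixes g :: "'a::euclidean_space \<Rightarrow> real"
  assumes g: "integrable lborel g" and gS: "\<And>x. x \<notin> box a b \<Longrightarrow> g x = 0"
    and box: "\<And>c d. (LINT x|lborel. indicator (box c d) x * g x) = 0"
  shows "AE x in lborel. g x = 0"
proof (rule density_unique_real[OF g integrable_zero])
  fix A :: "'a set" assume "A \<in> sets lborel"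
  then have A: "A \<in> sigma_sets UNIV (range (\<lambda>(a, b). box a b))" by (simp add: borel_eq_box)
  have "Int_stable (range (\<lambda>(a, b). box a b :: 'a set))"
    by (auto simp: Int_stable_def box_Int_box)
  moreover have "range (\<lambda>(a, b). box a b :: 'a set) \<subseteq> Pow UNIV" by simp
  ultimately have "(LINT x:A|lborel. g x) = 0" using A
  proof (induction rule: sigma_sets_induct_disjoint)
    case (basic A)
    then show ?case using box by (auto simp: set_lebesgue_integral_def)
  next
    case (compl A)
    then have [measurable]: "A \<in> sets borel" by (simp add: borel_eq_box)
    have "(LINT x:UNIV - A|lborel. g x) = (LINT x|lborel. g x - indicator A x * g x)"
      unfolding set_lebesgue_integral_def by (rule Bochner_Integration.integral_cong) (auto simp: indicator_def)
    also have "\<dots> = (LINT x|lborel. g x) - (LINT x|lborel. indicator A x * g x)"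
      using integrable_mult_indicator[of A lborel g] g by (intro Bochner_Integration.integral_diff) auto
    also have "(LINT x|lborel. g x) = (LINT x|lborel. indicator (box a b) x * g x)"
      using gS by (intro Bochner_Integration.integral_cong) (auto simp: indicator_def)
    finally show ?case using compl.IH box by (simp add: set_lebesgue_integral_def)
  next
    case (union A)
    then have "\<And>i. A i \<in> sets lborel" by (simp add: borel_eq_box image_subset_iff)
    moreover have "A i \<inter> A j = {}" if "i \<noteq> j" for i j
      using union(1) that by (simp add: disjoint_family_on_def)
    moreover have "set_integrable lborel (\<Union>i. A i) g"
      unfolding set_integrable_def using g calculation(1) by (intro integrable_mult_indicator) auto
    ultimately have "(LINT x:(\<Union>i. A i)|lborel. g x) = (\<Sum>i. LINT x:A i|lborel. g x)"
      by (rule lebesgue_integral_countable_add)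
    then show ?case using union by simp
  qed (simp add: set_lebesgue_integral_def)
  then show "(LINT x:A|lborel. g x) = (LINT x:A|lborel. 0)" by (simp add: set_lebesgue_integral_def)
qed

lemma AE_zero_of_integral_test_functions:
  fixes h :: "real^'n \<Rightarrow> real"
  assumes \<omega>: "open \<omega>" and h: "h \<in> L1_loc \<omega>"
    and test: "\<And>\<phi>. \<phi> \<in> test_functions \<omega> \<Longrightarrow> (LINT x|lebesgue_on \<omega>. h x * \<phi> x) = 0"
  shows "AE x in lebesgue_on \<omega>. h x = 0"
proof -
  have box: "AE x in lebesgue. x \<in> cbox a b \<longrightarrow> h x = 0" if ab: "cbox a b \<subseteq> \<omega>" for a b
  proof -
    let ?f = "\<lambda>x. indicator (box a b) x * h x"
    have "integrable (lebesgue_on (cbox a b)) h" using h ab by (simp add: L1_loc_def)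
    then have "integrable lebesgue (\<lambda>x. indicator (cbox a b) x *\<^sub>R h x)"
      by (simp add: integrable_restrict_space)
    from integrable_mult_indicator[OF _ this, of "box a b"]
    have "integrable lebesgue (\<lambda>x. indicator (box a b) x *\<^sub>R indicator (cbox a b) x *\<^sub>R h x)" by simp
    also have "(\<lambda>x. indicator (box a b) x *\<^sub>R indicator (cbox a b) x *\<^sub>R h x) = ?f"
    proof
      fix x show "indicator (box a b) x *\<^sub>R indicator (cbox a b) x *\<^sub>R h x = ?f x"
        using box_subset_cbox[of a b] by (cases "x \<in> box a b"; cases "x \<in> cbox a b") auto
    qed
    finally have f: "integrable lebesgue ?f" .
    \<comment> \<open>The Dynkin argument takes place in \<open>lborel\<close>, while
      \<open>?f\<close> is only Lebesgue measurable, so it is replaced by a Borel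
      representative.\<close>
    obtain g where g: "g \<in> borel_measurable lborel" "AE x in lborel. ?f x = g x"
      using completion_ex_borel_measurable_real[OF borel_measurable_integrable[OF f]] by blast
    \<comment> \<open>The indicator is applied once more because the representative may be nonzero
      on a null set outside the box, whereas \<open>AE_zero_of_integral_boxes\<close> wants it to
      vanish there everywhere.\<close>
    let ?g = "\<lambda>x. indicator (box a b) x * g x"
    have [measurable]: "g \<in> borel_measurable borel" using g(1) by simp
    have AE: "AE x in lebesgue. ?f x = ?g x"
      using AE_completion[OF g(2)] by eventually_elim (auto simp: indicator_def)
    have gm: "?g \<in> borel_measurable lborel" by measurable
    have gl: "?g \<in> borel_measurable lebesgue" using gm by (rule measurable_completion)
    have "integrable lebesgue ?g"
      by (rule integrable_cong_AE_imp[OF f gl]) (use AE in auto)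
    then have gi: "integrable lborel ?g" using integrable_completion[OF gm] by simp
    have g0: "AE x in lborel. ?g x = 0"
    proof (rule AE_zero_of_integral_boxes[OF gi, where a = a and b = b])
      fix c d :: "real^'n"
      obtain p q where pq: "box c d \<inter> box a b = box p q" "cbox c d \<inter> cbox a b = cbox p q"
        unfolding box_Int_box Int_interval by blast
      have "cbox p q \<subseteq> \<omega>" using pq(2) ab by blast
      from integral_box_eq_0[OF \<omega> h test this]
      have "(LINT x|lebesgue. indicator (box p q) x * h x) = 0" .
      moreover have "(LINT x|lebesgue. indicator (box p q) x * h x) = (LINT x|lebesgue. indicator (box c d) x * ?g x)"
      proof (rule integral_cong_AE)
        have eq: "indicator (box p q) x * h x = indicator (box c d) x * ?f x" for x
          unfolding pq(1)[symmetric] by (simp add: indicator_inter_arith)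
        show "AE x in lebesgue. indicator (box p q) x * h x = indicator (box c d) x * ?g x"
          using AE unfolding eq by eventually_elim simp
        show "(\<lambda>x. indicator (box p q) x * h x) \<in> borel_measurable lebesgue"
          unfolding eq by (rule borel_measurable_times[OF borel_measurable_indicator borel_measurable_integrable[OF f]]) simp
        show "(\<lambda>x. indicator (box c d) x * ?g x) \<in> borel_measurable lebesgue"
          by (rule borel_measurable_times[OF borel_measurable_indicator gl]) simp
      qed
      moreover have "(LINT x|lebesgue. indicator (box c d) x * ?g x) = (LINT x|lborel. indicator (box c d) x * ?g x)"
        by (rule integral_completion) measurable
      ultimately show "(LINT x|lborel. indicator (box c d) x * ?g x) = 0" by simp
    qed simp
    have "AE x in lebesgue. x \<notin> cbox a b - box a b"
      using negligible_frontier_interval[of a b] by (intro AE_not_in) (simp add: negligible_iff_null_sets)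
    then show ?thesis using AE_completion[OF g0] AE
    proof eventually_elim
      case (elim x)
      then show ?case by (cases "x \<in> box a b") auto
    qed
  qed
  obtain D where D: "countable D" "D \<subseteq> Pow \<omega>" "\<And>X. X \<in> D \<Longrightarrow> \<exists>a b. X = cbox a b" "\<Union>D = \<omega>"
    using open_countable_Union_open_cbox[OF \<omega>] by metis
  have "AE x in lebesgue. \<forall>X\<in>D. x \<in> X \<longrightarrow> h x = 0"
    using D(1)
  proof (subst AE_ball_countable)
    show "\<forall>X\<in>D. AE x in lebesgue. x \<in> X \<longrightarrow> h x = 0"
    proof
      fix X assume X: "X \<in> D"
      then obtain a b where "X = cbox a b" using D(3) by blast
      then show "AE x in lebesgue. x \<in> X \<longrightarrow> h x = 0" using box[of a b] X D(2) by blast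
    qed
  qed
  then have "AE x in lebesgue. x \<in> \<omega> \<longrightarrow> h x = 0"
    by eventually_elim (use D(4) in blast)
  then show ?thesis using \<omega> by (simp add: AE_restrict_space_iff)
qed

section \<open>Weak derivatives: agreement with classical ones, and uniqueness\<close>

lemma ex_neq_2: "\<exists>j :: 2. i \<noteq> j"
  by (rule exI[of _ "i + 1"]) simp


lemma integral_lebesgue_on_continuous:
  fixes f :: "'a::euclidean_space \<Rightarrow> real"
  assumes "continuous_on UNIV f" "bounded S" "S \<in> sets borel"
  shows "integrable (lebesgue_on S) f"
    and "(LINT x|lebesgue_on S. f x) = (LINT x|lborel. indicator S x * f x)"
proof -
  have S: "S \<in> sets lebesgue" using assms(3) by simp
  have [measurable]: "f \<in> borel_measurable borel" using assms(1) by (rule borel_measurable_continuous_onI)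
  have m: "(\<lambda>x. indicator S x * f x) \<in> borel_measurable lborel" using assms(3) by measurable
  show "integrable (lebesgue_on S) f"
    using integrable_lborel_continuous_bounded[OF assms] S
    by (simp add: integrable_restrict_space integrable_completion[OF m])
  show "(LINT x|lebesgue_on S. f x) = (LINT x|lborel. indicator S x * f x)"
    using S by (simp add: integral_restrict_space integral_completion[OF m])
qed

lemma DERIV_along_axis:
  fixes f :: "real^'n \<Rightarrow> real"
  assumes "f differentiable (at x)"
  shows "((\<lambda>t. f (x + t *\<^sub>R axis i 1)) has_real_derivative partial_deriv i f x) (at 0)"
proof -
  obtain f' where f': "(f has_derivative f') (at x)" using assms unfolding differentiable_def by blast
  have 1: "((\<lambda>t::real. x + t *\<^sub>R axis i 1) has_derivative (\<lambda>t. t *\<^sub>R axis i 1)) (at 0)"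
    by (auto intro!: derivative_eq_intros)
  have "(f has_derivative f') (at (x + 0 *\<^sub>R axis i 1))" using f' by simp
  from has_derivative_compose[OF 1 this]
  have "((\<lambda>t. f (x + t *\<^sub>R axis i 1)) has_derivative (\<lambda>t. f' (t *\<^sub>R axis i 1))) (at 0)" .
  moreover have "f' (t *\<^sub>R axis i 1) = partial_deriv i f x * t" for t
    using linear_cmul[OF has_derivative_linear[OF f'], of t "axis i 1"]
    by (simp add: has_derivative_partial_deriv[OF f'] mult.commute)
  ultimately show ?thesis by (simp add: has_field_derivative_def)
qed

lemma continuous_in_L1_loc: "continuous_on UNIV f \<Longrightarrow> f \<in> L1_loc \<omega>"
  by (auto simp: L1_loc_def intro!: integral_lebesgue_on_continuous compact_imp_bounded borel_compact)

text \<open>Integration by parts is read off from the boundary estimate: the product of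
  \<open>\<phi>\<close> with a test function vanishes on the boundary, so the integral of its
  derivative is 0.\<close>

lemma smooth_has_weak_partial:
  fixes \<phi> :: "real^2 \<Rightarrow> real"
  assumes \<omega>: "open \<omega>" "bounded \<omega>" and \<phi>: "smooth \<phi>"
  shows "has_weak_partial \<omega> i \<phi> (partial_deriv i \<phi>)"
  unfolding has_weak_partial_def
proof (intro conjI ballI)
  have c\<phi>: "continuous_on UNIV \<phi>" "continuous_on UNIV (partial_deriv i \<phi>)"
    using \<phi> by (auto intro: smooth_continuous smooth_partial_deriv)
  then show "\<phi> \<in> L1_loc \<omega>" "partial_deriv i \<phi> \<in> L1_loc \<omega>" by (auto intro: continuous_in_L1_loc)
  fix \<psi> assume test: "\<psi> \<in> test_functions \<omega>"
  then have \<psi>: "smooth \<psi>" by (simp add: test_functions_def)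
  obtain K where K: "compact K" "K \<subseteq> \<omega>" "\<forall>x. x \<notin> K \<longrightarrow> \<psi> x = 0"
    using test_function_support[OF test] by blast
  have c\<psi>: "continuous_on UNIV \<psi>" "continuous_on UNIV (partial_deriv i \<psi>)"
    using \<psi> by (auto intro: smooth_continuous smooth_partial_deriv)
  obtain j where ij: "i \<noteq> j" using ex_neq_2 by blast
  let ?F = "\<lambda>x. \<phi> x * \<psi> x"
  let ?D = "\<lambda>x. \<phi> x * partial_deriv i \<psi> x + partial_deriv i \<phi> x * \<psi> x"
  have bo: "\<omega> \<in> sets borel" using \<omega>(1) by simp
  have D: "continuous_on UNIV ?D" using c\<phi> c\<psi> by (intro continuous_intros)
  have "ennreal \<bar>LINT x|lborel. indicator \<omega> x * ?D x\<bar> \<le> 2 * (\<integral>\<^sup>+x. ennreal \<bar>?F x\<bar> \<partial>boundary_measure \<omega>)"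
  proof (rule abs_integral_partial_le_boundary[OF ij \<omega> D])
    show "continuous_on UNIV ?F" using c\<phi> c\<psi> by (intro continuous_intros)
    fix x
    have "partial_deriv i ?F x = ?D x"
      by (intro partial_deriv_mult smooth_differentiable \<phi> \<psi>)
    with DERIV_along_axis[OF smooth_differentiable[OF smooth_mult[OF \<phi> \<psi>]], of x i]
    show "((\<lambda>t. ?F (x + t *\<^sub>R axis i 1)) has_real_derivative ?D x) (at 0)" by (simp only:)
  qed
  also have "(\<integral>\<^sup>+x. ennreal \<bar>?F x\<bar> \<partial>boundary_measure \<omega>) = (\<integral>\<^sup>+x. 0 \<partial>boundary_measure \<omega>)"
  proof (rule nn_integral_cong)
    fix x assume "x \<in> space (boundary_measure \<omega>)"
    then have "x \<in> frontier \<omega>" by (simp add: boundary_measure_def space_restrict_space)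
    then have "x \<notin> K" using K(2) \<omega>(1) by (auto simp: frontier_def interior_open)
    then show "ennreal \<bar>?F x\<bar> = 0" using K(3) by simp
  qed
  finally have "(LINT x|lborel. indicator \<omega> x * ?D x) = 0" by (simp add: ennreal_eq_0_iff)
  then have "(LINT x|lebesgue_on \<omega>. ?D x) = 0"
    using integral_lebesgue_on_continuous(2)[OF D \<omega>(2) bo] by simp
  moreover have "(LINT x|lebesgue_on \<omega>. ?D x)
      = (LINT x|lebesgue_on \<omega>. \<phi> x * partial_deriv i \<psi> x) + (LINT x|lebesgue_on \<omega>. partial_deriv i \<phi> x * \<psi> x)"
    using c\<phi> c\<psi> bo \<omega>(2)
    by (intro Bochner_Integration.integral_add integral_lebesgue_on_continuous) (auto intro!: continuous_intros)
  ultimately show "(LINT x|lebesgue_on \<omega>. \<phi> x * partial_deriv i \<psi> x) = - (LINT x|lebesgue_on \<omega>. partial_deriv i \<phi> x * \<psi> x)"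
    by simp
qed

lemma L1_loc_diff: "f \<in> L1_loc \<omega> \<Longrightarrow> g \<in> L1_loc \<omega> \<Longrightarrow> (\<lambda>x. f x - g x) \<in> L1_loc \<omega>"
  by (auto simp: L1_loc_def)

lemma integrable_L1_loc_test:
  assumes \<omega>: "open \<omega>" and f: "f \<in> L1_loc \<omega>" and \<psi>: "\<psi> \<in> test_functions \<omega>"
  shows "integrable (lebesgue_on \<omega>) (\<lambda>x. f x * \<psi> x)"
    and "integrable (lebesgue_on \<omega>) (\<lambda>x. f x * partial_deriv i \<psi> x)"
proof -
  obtain K where K: "compact K" "K \<subseteq> \<omega>" "\<forall>x. x \<notin> K \<longrightarrow> \<psi> x = 0" "\<forall>x i. x \<notin> K \<longrightarrow> partial_deriv i \<psi> x = 0"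
    using test_function_support[OF \<psi>] by blast
  have s: "smooth \<psi>" using \<psi> by (simp add: test_functions_def)
  show "integrable (lebesgue_on \<omega>) (\<lambda>x. f x * \<psi> x)"
    by (rule integrable_L1_loc_mult[OF \<omega> f K(1,2) smooth_continuous[OF s]]) (use K(3) in blast)
  show "integrable (lebesgue_on \<omega>) (\<lambda>x. f x * partial_deriv i \<psi> x)"
    by (rule integrable_L1_loc_mult[OF \<omega> f K(1,2) smooth_continuous[OF smooth_partial_deriv[OF s]]]) (use K(4) in blast)
qed

lemma has_weak_partial_diff:
  assumes \<omega>: "open \<omega>" and "has_weak_partial \<omega> i f g" "has_weak_partial \<omega> i f' g'"
  shows "has_weak_partial \<omega> i (\<lambda>x. f x - f' x) (\<lambda>x. g x - g' x)"
  unfolding has_weak_partial_def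
proof (intro conjI ballI)
  have L: "f \<in> L1_loc \<omega>" "g \<in> L1_loc \<omega>" "f' \<in> L1_loc \<omega>" "g' \<in> L1_loc \<omega>"
    using assms by (auto simp: has_weak_partial_def)
  then show "(\<lambda>x. f x - f' x) \<in> L1_loc \<omega>" "(\<lambda>x. g x - g' x) \<in> L1_loc \<omega>" by (auto intro: L1_loc_diff)
  fix \<psi> assume \<psi>: "\<psi> \<in> test_functions \<omega>"
  then show "(LINT x|lebesgue_on \<omega>. (f x - f' x) * partial_deriv i \<psi> x) = - (LINT x|lebesgue_on \<omega>. (g x - g' x) * \<psi> x)"
    using assms(2,3) integrable_L1_loc_test[OF \<omega> L(1) \<psi>] integrable_L1_loc_test[OF \<omega> L(2) \<psi>]
      integrable_L1_loc_test[OF \<omega> L(3) \<psi>] integrable_L1_loc_test[OF \<omega> L(4) \<psi>]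
    by (simp add: has_weak_partial_def left_diff_distrib)
qed

text \<open>Applied to a difference it yields uniqueness of weak derivatives; applied to
  \<open>f\<close> itself it later turns f = 0 into a vanishing derivative.\<close>

lemma has_weak_partial_AE_zero:
  assumes \<omega>: "open \<omega>" and w: "has_weak_partial \<omega> i f g" and f: "AE x in lebesgue_on \<omega>. f x = 0"
  shows "AE x in lebesgue_on \<omega>. g x = 0"
proof (rule AE_zero_of_integral_test_functions[OF \<omega>])
  show "g \<in> L1_loc \<omega>" using w by (simp add: has_weak_partial_def)
  fix \<psi> assume \<psi>: "\<psi> \<in> test_functions \<omega>"
  have "f \<in> L1_loc \<omega>" using w by (simp add: has_weak_partial_def)
  have "(LINT x|lebesgue_on \<omega>. f x * partial_deriv i \<psi> x) = (LINT x|lebesgue_on \<omega>. 0)"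
    by (rule integral_cong_AE)
      (use f integrable_L1_loc_test(2)[OF \<omega> \<open>f \<in> L1_loc \<omega>\<close> \<psi>] in auto)
  then show "(LINT x|lebesgue_on \<omega>. g x * \<psi> x) = 0" using w \<psi> by (simp add: has_weak_partial_def)
qed

lemma has_weak_partial_unique:
  assumes "open \<omega>" "has_weak_partial \<omega> i f g" "has_weak_partial \<omega> i f g'"
  shows "AE x in lebesgue_on \<omega>. g x = g' x"
  using has_weak_partial_AE_zero[OF assms(1) has_weak_partial_diff[OF assms]] by simp

lemma has_weak_partial_weak_partial:
  "has_weak_partial \<omega> i f g \<Longrightarrow> has_weak_partial \<omega> i f (weak_partial \<omega> i f)"
  unfolding weak_partial_def by (rule someI[of "has_weak_partial \<omega> i f"])

text \<open>This is completeness of Lebesgue measure. By definition \<open>weak_partial\<close> is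
  only in \<open>L1_loc\<close>, which speaks of compact subsets; measurability on all of the domain
  is inherited from an L^2 representative.\<close>

lemma borel_measurable_lebesgue_on_AE:
  fixes f g :: "'a::euclidean_space \<Rightarrow> real"
  assumes S: "S \<in> sets lebesgue" and f: "f \<in> borel_measurable (lebesgue_on S)" and AE: "AE x in lebesgue_on S. f x = g x"
  shows "g \<in> borel_measurable (lebesgue_on S)"
proof -
  have "(\<lambda>x. indicator S x *\<^sub>R f x) \<in> borel_measurable lebesgue"
    using f S by (simp add: borel_measurable_restrict_space_iff)
  moreover have "AE x in lebesgue. indicator S x *\<^sub>R f x = indicator S x *\<^sub>R g x"
    using AE S by (auto simp: AE_restrict_space_iff indicator_def elim!: AE_mp)
  ultimately have "(\<lambda>x. indicator S x *\<^sub>R g x) \<in> borel_measurable lebesgue"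
    by (rule borel_measurable_AE)
  then show ?thesis using S by (simp add: borel_measurable_restrict_space_iff)
qed

text \<open>\<open>H1_norm\<close> contains the chosen weak derivative of \<phi>_n - f. Uniqueness
  identifies it almost everywhere with the classical derivative of \<phi>_n minus \<open>g\<close>,
  for which convergence is wanted.\<close>

lemma smooth_approximation:
  fixes f :: "real^2 \<Rightarrow> real"
  assumes \<omega>: "open \<omega>" "bounded \<omega>" and f: "f \<in> H1 \<omega>" and \<phi>: "\<And>n. smooth (\<phi> n)"
    and lim: "(\<lambda>n. H1_norm \<omega> (\<lambda>x. \<phi> n x - f x)) \<longlonglongrightarrow> 0"
    and g: "g \<in> L2 \<omega>" "has_weak_partial \<omega> i f g"
  shows "(\<lambda>n. LINT x|lebesgue_on \<omega>. (\<phi> n x - f x)\<^sup>2) \<longlonglongrightarrow> 0"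
    and "(\<lambda>n. LINT x|lebesgue_on \<omega>. (partial_deriv i (\<phi> n) x - g x)\<^sup>2) \<longlonglongrightarrow> 0"
proof -
  let ?w = "\<lambda>k n. weak_partial \<omega> k (\<lambda>x. \<phi> n x - f x)"
  let ?A = "\<lambda>n. LINT x|lebesgue_on \<omega>. (\<phi> n x - f x)\<^sup>2"
  let ?B = "\<lambda>k n. LINT x|lebesgue_on \<omega>. (?w k n x)\<^sup>2"
  have lim2: "(\<lambda>n. (H1_norm \<omega> (\<lambda>x. \<phi> n x - f x))\<^sup>2) \<longlonglongrightarrow> 0"
    using tendsto_power[OF lim, of 2] by simp
  have pos: "0 \<le> ?A n" "0 \<le> ?B k n" for k n by (auto intro!: Bochner_Integration.integral_nonneg)
  have norm: "(H1_norm \<omega> (\<lambda>x. \<phi> n x - f x))\<^sup>2 = ?A n + (\<Sum>k\<in>UNIV. ?B k n)" for n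
    unfolding H1_norm_def using pos by (intro real_sqrt_pow2 add_nonneg_nonneg sum_nonneg) auto
  have le: "?A n \<le> (H1_norm \<omega> (\<lambda>x. \<phi> n x - f x))\<^sup>2" "?B i n \<le> (H1_norm \<omega> (\<lambda>x. \<phi> n x - f x))\<^sup>2" for n
  proof -
    have "?B i n \<le> (\<Sum>k\<in>UNIV. ?B k n)" using pos by (intro member_le_sum) auto
    moreover have "0 \<le> (\<Sum>k\<in>UNIV. ?B k n)" by (intro sum_nonneg pos(2))
    ultimately show "?A n \<le> (H1_norm \<omega> (\<lambda>x. \<phi> n x - f x))\<^sup>2" "?B i n \<le> (H1_norm \<omega> (\<lambda>x. \<phi> n x - f x))\<^sup>2"
      unfolding norm using pos(1)[of n] by (simp, linarith)
  qed
  show "?A \<longlonglongrightarrow> 0"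
    by (rule tendsto_sandwich[OF _ _ tendsto_const lim2]) (auto intro: always_eventually simp: pos le)
  have "?B i \<longlonglongrightarrow> 0"
    by (rule tendsto_sandwich[OF _ _ tendsto_const lim2]) (auto intro: always_eventually simp: pos le)
  moreover have "?B i n = (LINT x|lebesgue_on \<omega>. (partial_deriv i (\<phi> n) x - g x)\<^sup>2)" for n
  proof -
    let ?d = "\<lambda>x. partial_deriv i (\<phi> n) x - g x"
    have 1: "has_weak_partial \<omega> i (\<lambda>x. \<phi> n x - f x) ?d"
      by (rule has_weak_partial_diff[OF \<omega>(1) smooth_has_weak_partial[OF \<omega> \<phi>] g(2)])
    have AE: "AE x in lebesgue_on \<omega>. ?d x = ?w i n x"
      by (rule has_weak_partial_unique[OF \<omega>(1) 1 has_weak_partial_weak_partial[OF 1]])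
    have "partial_deriv i (\<phi> n) \<in> borel_measurable (lebesgue_on \<omega>)"
      by (rule borel_measurable_integrable[OF integral_lebesgue_on_continuous(1)[OF smooth_continuous[OF smooth_partial_deriv[OF \<phi>]] \<omega>(2)]])
        (use \<omega> in simp)
    then have d: "?d \<in> borel_measurable (lebesgue_on \<omega>)" using g(1) by (auto simp: L2_def)
    have w: "?w i n \<in> borel_measurable (lebesgue_on \<omega>)"
      by (rule borel_measurable_lebesgue_on_AE[OF _ d AE]) (use \<omega> in simp)
    show ?thesis by (rule integral_cong_AE) (use d w AE in auto)
  qed
  ultimately show "(\<lambda>n. LINT x|lebesgue_on \<omega>. (partial_deriv i (\<phi> n) x - g x)\<^sup>2) \<longlonglongrightarrow> 0" by simp
qed

section \<open>Functions of zero trace\<close>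

text \<open>Young's inequality. The free weight \<open>e\<close> lets a product of an approximation
  error and a fixed function be split so that the fixed part carries an arbitrarily small
  coefficient.\<close>

lemma abs_mult_le_weighted:
  fixes a b e :: real
  assumes "0 < e"
  shows "2 * \<bar>a\<bar> * \<bar>b\<bar> \<le> a\<^sup>2 / e + e * b\<^sup>2"
proof -
  have "0 \<le> (\<bar>a\<bar> / sqrt e - sqrt e * \<bar>b\<bar>)\<^sup>2" by simp
  also have "\<dots> = a\<^sup>2 / e + e * b\<^sup>2 - 2 * \<bar>a\<bar> * \<bar>b\<bar>"
    using assms by (simp add: power2_diff power_divide power_mult_distrib)
  finally show ?thesis by simp
qed

text \<open>\<open>H\<close> stands for one of the functions \<open>s\<^sup>2\<close> and \<open>s \<bar>s\<bar>\<close>: their quadratic growth makes the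
  boundary term controllable by the \<open>L\<^sup>2\<close> norm of the trace alone, without knowing
  that the boundary has finite length.\<close>

lemma integral_partial_zero_trace:
  fixes f g :: "real^2 \<Rightarrow> real" and H h :: "real \<Rightarrow> real" and p q :: real
  assumes \<omega>: "open \<omega>" "bounded \<omega>" and tr: "has_trace \<omega> f (\<lambda>_. 0)"
    and g: "g \<in> L2 \<omega>" "has_weak_partial \<omega> i f g"
    and H: "\<And>s. (H has_real_derivative h s) (at s)" "\<And>s. \<bar>H s\<bar> \<le> s\<^sup>2"
      "\<And>a b. \<bar>H a - H b\<bar> \<le> \<bar>a - b\<bar> * (\<bar>a - b\<bar> + 2 * \<bar>b\<bar>)"
    and h: "\<And>s. \<bar>h s\<bar> \<le> 2 * \<bar>s\<bar>" "\<And>a b. \<bar>h a - h b\<bar> \<le> 2 * \<bar>a - b\<bar>" "continuous_on UNIV h"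
  shows "integrable (lebesgue_on \<omega>) (\<lambda>x. q * H (f x) + (p + q * x $ i) * (h (f x) * g x))"
    and "(LINT x|lebesgue_on \<omega>. q * H (f x) + (p + q * x $ i) * (h (f x) * g x)) = 0"
proof -
  let ?M = "lebesgue_on \<omega>"
  let ?P = "\<lambda>x::real^2. p + q * x $ i"
  \<comment> \<open>Formally the derivative in direction \<open>i\<close> of (p + q y_i) H(f). The
    affine weight covers both the constant weight and the weight y_i.\<close>
  let ?D = "\<lambda>x. q * H (f x) + ?P x * (h (f x) * g x)"
  have bo: "\<omega> \<in> sets borel" using \<omega>(1) by simp
  have fH1: "f \<in> H1 \<omega>" using tr by (simp add: has_trace_def)
  obtain \<phi> :: "nat \<Rightarrow> real^2 \<Rightarrow> real" where \<phi>: "\<And>n. smooth (\<phi> n)"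
    and lim1: "(\<lambda>n. H1_norm \<omega> (\<lambda>x. \<phi> n x - f x)) \<longlonglongrightarrow> 0"
    and lim2: "(\<lambda>n. \<integral>\<^sup>+x. ennreal ((\<phi> n x - 0)\<^sup>2) \<partial>boundary_measure \<omega>) \<longlonglongrightarrow> 0"
    using tr unfolding has_trace_def by blast
  let ?d = "\<lambda>n. partial_deriv i (\<phi> n)"
  let ?A = "\<lambda>n. LINT x|?M. (\<phi> n x - f x)\<^sup>2"
  let ?B = "\<lambda>n. LINT x|?M. (?d n x - g x)\<^sup>2"
  let ?Dn = "\<lambda>n x. q * H (\<phi> n x) + ?P x * (h (\<phi> n x) * ?d n x)"
  note AB = smooth_approximation[OF \<omega> fH1 \<phi> lim1 g]
  have cH: "continuous_on UNIV H"
    using H(1) by (meson DERIV_continuous_on has_field_derivative_at_within)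
  have c\<phi>: "continuous_on UNIV (\<phi> n)" "continuous_on UNIV (?d n)" for n
    using \<phi> by (auto intro: smooth_continuous smooth_partial_deriv)
  have [measurable]: "H \<in> borel_measurable borel" "h \<in> borel_measurable borel"
    using cH h(3) by (auto intro: borel_measurable_continuous_onI)
  have fL2: "f \<in> L2 \<omega>" using fH1 by (simp add: H1_def)
  have meas[measurable]: "f \<in> borel_measurable ?M" "g \<in> borel_measurable ?M"
    using fL2 g(1) by (auto simp: L2_def)
  have \<phi>m[measurable]: "\<phi> n \<in> borel_measurable ?M" "?d n \<in> borel_measurable ?M" for n
    using integral_lebesgue_on_continuous(1)[OF c\<phi>(1) \<omega>(2) bo]
      integral_lebesgue_on_continuous(1)[OF c\<phi>(2) \<omega>(2) bo] by auto
  have cP: "continuous_on UNIV ?P" by (intro continuous_intros)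
  have Pm[measurable]: "?P \<in> borel_measurable ?M"
    using integral_lebesgue_on_continuous(1)[OF cP \<omega>(2) bo] by auto
  have f2: "integrable ?M (\<lambda>x. (f x)\<^sup>2)" and g2: "integrable ?M (\<lambda>x. (g x)\<^sup>2)"
    using fL2 g(1) by (auto simp: L2_def)
  have diff2: "integrable ?M (\<lambda>x. (u x - v x)\<^sup>2)"
    if u: "continuous_on UNIV u" and v: "v \<in> borel_measurable ?M" "integrable ?M (\<lambda>x. (v x)\<^sup>2)" for u v :: "real^2 \<Rightarrow> real"
  proof (rule Bochner_Integration.integrable_bound)
    have u2: "integrable ?M (\<lambda>x. (u x)\<^sup>2)"
      by (rule integral_lebesgue_on_continuous(1)[OF _ \<omega>(2) bo]) (intro continuous_intros u)
    show "integrable ?M (\<lambda>x. 2 * (u x)\<^sup>2 + 2 * (v x)\<^sup>2)" using u2 v(2) by simp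
    have "u \<in> borel_measurable ?M" using integral_lebesgue_on_continuous(1)[OF u \<omega>(2) bo] by auto
    then show "(\<lambda>x. (u x - v x)\<^sup>2) \<in> borel_measurable ?M" using v(1) by measurable
    have "(a - b)\<^sup>2 \<le> 2 * a\<^sup>2 + 2 * b\<^sup>2" for a b :: real
      using sum_squares_ge_zero[of "a + b" 0] by (simp add: power2_eq_square algebra_simps)
    then show "AE x in ?M. norm ((u x - v x)\<^sup>2) \<le> norm (2 * (u x)\<^sup>2 + 2 * (v x)\<^sup>2)" by simp
  qed
  have a2: "integrable ?M (\<lambda>x. (\<phi> n x - f x)\<^sup>2)" for n by (rule diff2[OF c\<phi>(1) meas(1) f2])
  have b2: "integrable ?M (\<lambda>x. (?d n x - g x)\<^sup>2)" for n by (rule diff2[OF c\<phi>(2) meas(2) g2])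
  obtain B where B: "\<And>x. x \<in> closure \<omega> \<Longrightarrow> norm x \<le> B"
    using bounded_closure[OF \<omega>(2)] bounded_iff by blast
  \<comment> \<open>One constant for |q| and for the weight on the closure, since both the interior
    and the boundary integrals use it.\<close>
  define R where "R = \<bar>p\<bar> + \<bar>q\<bar> + \<bar>q\<bar> * \<bar>B\<bar>"
  have R: "\<bar>q\<bar> \<le> R" "0 \<le> R" by (auto simp: R_def)
  have PR: "\<bar>?P x\<bar> \<le> R" if "x \<in> closure \<omega>" for x
  proof -
    have "\<bar>x $ i\<bar> \<le> \<bar>B\<bar>" using B[OF that] component_le_norm_cart[of x i] by linarith
    then have "\<bar>q * x $ i\<bar> \<le> \<bar>q\<bar> * \<bar>B\<bar>" by (simp add: abs_mult mult_left_mono)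
    then show ?thesis unfolding R_def using abs_triangle_ineq[of p "q * x $ i"] by linarith
  qed
  have PR': "\<bar>?P x\<bar> \<le> R" if "x \<in> space ?M" for x
    using PR[of x] that closure_subset[of \<omega>] by (auto simp: space_restrict_space)
  have Dm: "?D \<in> borel_measurable ?M" by measurable
  have D_int: "integrable ?M ?D"
  proof (rule Bochner_Integration.integrable_bound)
    show "integrable ?M (\<lambda>x. R * (2 * (f x)\<^sup>2 + (g x)\<^sup>2))" using f2 g2 by simp
    show "AE x in ?M. norm (?D x) \<le> norm (R * (2 * (f x)\<^sup>2 + (g x)\<^sup>2))"
    proof (rule AE_I2)
      fix x assume x: "x \<in> space ?M"
      have "\<bar>h (f x) * g x\<bar> \<le> 2 * \<bar>f x\<bar> * \<bar>g x\<bar>" unfolding abs_mult by (intro mult_right_mono h) auto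
      also have "\<dots> \<le> (f x)\<^sup>2 + (g x)\<^sup>2" using abs_mult_le_weighted[of 1 "f x" "g x"] by simp
      finally have 1: "\<bar>?P x * (h (f x) * g x)\<bar> \<le> R * ((f x)\<^sup>2 + (g x)\<^sup>2)"
        unfolding abs_mult[of "?P x"] using PR'[OF x] by (intro mult_mono) auto
      have 2: "\<bar>q * H (f x)\<bar> \<le> R * (f x)\<^sup>2" unfolding abs_mult using R H(2) by (intro mult_mono) auto
      have "norm (?D x) \<le> R * (2 * (f x)\<^sup>2 + (g x)\<^sup>2)"
        using 1 2 abs_triangle_ineq[of "q * H (f x)" "?P x * (h (f x) * g x)"] by (simp add: algebra_simps)
      then show "norm (?D x) \<le> norm (R * (2 * (f x)\<^sup>2 + (g x)\<^sup>2))" by simp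
    qed
  qed (rule Dm)
  then show "integrable ?M ?D" .
  have cDn: "continuous_on UNIV (?Dn n)" for n
    by (intro continuous_intros continuous_on_compose2[OF cH c\<phi>(1)] continuous_on_compose2[OF h(3) c\<phi>(1)] c\<phi>(2)) auto
  have Dn_int: "integrable ?M (?Dn n)" for n
    by (rule integral_lebesgue_on_continuous(1)[OF cDn \<omega>(2) bo])
  obtain j where ij: "i \<noteq> j" using ex_neq_2 by blast
  have bdry: "ennreal \<bar>LINT x|?M. ?Dn n x\<bar> \<le> 2 * ennreal R * (\<integral>\<^sup>+x. ennreal ((\<phi> n x - 0)\<^sup>2) \<partial>boundary_measure \<omega>)" for n
  proof -
    let ?F = "\<lambda>x. ?P x * H (\<phi> n x)"
    have cF: "continuous_on UNIV ?F"
      by (intro continuous_intros continuous_on_compose2[OF cH c\<phi>(1)]) auto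
    have "ennreal \<bar>LINT x|lborel. indicator \<omega> x * ?Dn n x\<bar> \<le> 2 * (\<integral>\<^sup>+x. ennreal \<bar>?F x\<bar> \<partial>boundary_measure \<omega>)"
    proof (rule abs_integral_partial_le_boundary[OF ij \<omega> cDn cF])
      fix x :: "real^2"
      have 1: "((\<lambda>t. \<phi> n (x + t *\<^sub>R axis i 1)) has_real_derivative ?d n x) (at 0)"
        by (rule DERIV_along_axis[OF smooth_differentiable[OF \<phi>]])
      have 2: "((\<lambda>t. H (\<phi> n (x + t *\<^sub>R axis i 1))) has_real_derivative h (\<phi> n x) * ?d n x) (at 0)"
        using DERIV_chain2[OF H(1) 1] by simp
      have "((\<lambda>t. ?P (x + t *\<^sub>R axis i 1)) has_real_derivative q) (at 0)"
        by (auto intro!: derivative_eq_intros simp: axis_def)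
      from DERIV_mult[OF this 2]
      show "((\<lambda>t. ?F (x + t *\<^sub>R axis i 1)) has_real_derivative ?Dn n x) (at 0)"
        by (simp add: algebra_simps)
    qed
    also have "(\<integral>\<^sup>+x. ennreal \<bar>?F x\<bar> \<partial>boundary_measure \<omega>)
        \<le> (\<integral>\<^sup>+x. ennreal R * ennreal ((\<phi> n x - 0)\<^sup>2) \<partial>boundary_measure \<omega>)"
    proof (rule nn_integral_mono)
      fix x assume "x \<in> space (boundary_measure \<omega>)"
      then have "x \<in> closure \<omega>" by (auto simp: boundary_measure_def space_restrict_space frontier_def)
      then have "\<bar>?F x\<bar> \<le> R * (\<phi> n x)\<^sup>2"
        unfolding abs_mult using PR H(2) R by (intro mult_mono) auto
      then show "ennreal \<bar>?F x\<bar> \<le> ennreal R * ennreal ((\<phi> n x - 0)\<^sup>2)"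
        using R(2) by (simp add: ennreal_mult[symmetric] ennreal_leI)
    qed
    also have "\<dots> = ennreal R * (\<integral>\<^sup>+x. ennreal ((\<phi> n x - 0)\<^sup>2) \<partial>boundary_measure \<omega>)"
    proof (rule nn_integral_cmult)
      have "\<phi> n \<in> borel_measurable borel" using c\<phi>(1) by (rule borel_measurable_continuous_onI)
      then have "(\<lambda>x. ennreal ((\<phi> n x - 0)\<^sup>2)) \<in> borel_measurable hausdorff1" by measurable
      then show "(\<lambda>x. ennreal ((\<phi> n x - 0)\<^sup>2)) \<in> borel_measurable (boundary_measure \<omega>)"
        unfolding boundary_measure_def by (rule measurable_restrict_space1)
    qed
    finally show ?thesis
      using integral_lebesgue_on_continuous(2)[OF cDn[of n] \<omega>(2) bo] by (simp add: mult.assoc mult_left_mono)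
  qed
  have "(\<lambda>n. 2 * ennreal R * (\<integral>\<^sup>+x. ennreal ((\<phi> n x - 0)\<^sup>2) \<partial>boundary_measure \<omega>)) \<longlonglongrightarrow> 2 * ennreal R * 0"
    by (intro ennreal_tendsto_cmult lim2) (simp add: ennreal_mult_less_top)
  then have "(\<lambda>n. 2 * ennreal R * (\<integral>\<^sup>+x. ennreal ((\<phi> n x - 0)\<^sup>2) \<partial>boundary_measure \<omega>)) \<longlonglongrightarrow> 0" by simp
  then have "(\<lambda>n. ennreal \<bar>LINT x|?M. ?Dn n x\<bar>) \<longlonglongrightarrow> 0"
    by (rule tendsto_sandwich[OF _ _ tendsto_const, rotated 2]) (intro always_eventually allI zero_le bdry)+
  then have limDn: "(\<lambda>n. \<bar>LINT x|?M. ?Dn n x\<bar>) \<longlonglongrightarrow> 0"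
    using tendsto_ennreal_iff[of "\<lambda>n. \<bar>LINT x|?M. ?Dn n x\<bar>" sequentially 0] by simp
  \<comment> \<open>Squared errors carry coefficients that blow up as \<open>e\<close> tends to 0,
    but for fixed \<open>e\<close> their integrals vanish as n grows; the terms in \<open>f\<close>
    and \<open>g\<close> alone carry the factor \<open>e\<close>. Hence the limit in n is taken
    first, then that in \<open>e\<close>.\<close>
  have pointwise: "\<bar>?Dn n x - ?D x\<bar>
      \<le> R * ((2 + 2 / e) * (\<phi> n x - f x)\<^sup>2 + (1 + 1 / e) * (?d n x - g x)\<^sup>2 + e * (2 * (f x)\<^sup>2 + (g x)\<^sup>2))"
    if "0 < e" and x: "x \<in> space ?M" for e n x
  proof -
    define a where "a = \<phi> n x - f x"
    define b where "b = ?d n x - g x"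
    have "\<bar>H (\<phi> n x) - H (f x)\<bar> \<le> \<bar>a\<bar> * (\<bar>a\<bar> + 2 * \<bar>f x\<bar>)" unfolding a_def by (rule H(3))
    also have "\<dots> = a\<^sup>2 + 2 * \<bar>a\<bar> * \<bar>f x\<bar>" by (simp add: algebra_simps power2_eq_square)
    also have "\<dots> \<le> a\<^sup>2 + (a\<^sup>2 / e + e * (f x)\<^sup>2)" using abs_mult_le_weighted[OF \<open>0 < e\<close>] by (intro add_left_mono)
    finally have 1: "\<bar>H (\<phi> n x) - H (f x)\<bar> \<le> a\<^sup>2 + (a\<^sup>2 / e + e * (f x)\<^sup>2)" .
    \<comment> \<open>Expanding around \<open>f\<close> and \<open>g\<close> leaves an approximation
      error in every term.\<close>
    have "h (\<phi> n x) * ?d n x - h (f x) * g x = (h (\<phi> n x) - h (f x)) * b + (h (\<phi> n x) - h (f x)) * g x + h (f x) * b"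
      by (simp add: b_def algebra_simps)
    then have "\<bar>h (\<phi> n x) * ?d n x - h (f x) * g x\<bar>
        \<le> \<bar>h (\<phi> n x) - h (f x)\<bar> * \<bar>b\<bar> + \<bar>h (\<phi> n x) - h (f x)\<bar> * \<bar>g x\<bar> + \<bar>h (f x)\<bar> * \<bar>b\<bar>"
      unfolding abs_mult[symmetric] by linarith
    also have "\<dots> \<le> 2 * \<bar>a\<bar> * \<bar>b\<bar> + 2 * \<bar>a\<bar> * \<bar>g x\<bar> + 2 * \<bar>f x\<bar> * \<bar>b\<bar>"
      unfolding a_def by (intro add_mono mult_right_mono h) auto
    also have "\<dots> = 2 * \<bar>a\<bar> * \<bar>b\<bar> + 2 * \<bar>a\<bar> * \<bar>g x\<bar> + 2 * \<bar>b\<bar> * \<bar>f x\<bar>" by simp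
    also have "\<dots> \<le> (a\<^sup>2 + b\<^sup>2) + (a\<^sup>2 / e + e * (g x)\<^sup>2) + (b\<^sup>2 / e + e * (f x)\<^sup>2)"
      using abs_mult_le_weighted[of 1 a b] abs_mult_le_weighted[OF \<open>0 < e\<close>, of a "g x"]
        abs_mult_le_weighted[OF \<open>0 < e\<close>, of b "f x"]
      by (intro add_mono) auto
    finally have 2: "\<bar>h (\<phi> n x) * ?d n x - h (f x) * g x\<bar>
        \<le> (a\<^sup>2 + b\<^sup>2) + (a\<^sup>2 / e + e * (g x)\<^sup>2) + (b\<^sup>2 / e + e * (f x)\<^sup>2)" .
    have "?Dn n x - ?D x = q * (H (\<phi> n x) - H (f x)) + ?P x * (h (\<phi> n x) * ?d n x - h (f x) * g x)"
      by (simp add: algebra_simps)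
    then have "\<bar>?Dn n x - ?D x\<bar> \<le> \<bar>q\<bar> * \<bar>H (\<phi> n x) - H (f x)\<bar> + \<bar>?P x\<bar> * \<bar>h (\<phi> n x) * ?d n x - h (f x) * g x\<bar>"
      unfolding abs_mult[symmetric] by linarith
    also have "\<dots> \<le> R * (a\<^sup>2 + (a\<^sup>2 / e + e * (f x)\<^sup>2)) + R * ((a\<^sup>2 + b\<^sup>2) + (a\<^sup>2 / e + e * (g x)\<^sup>2) + (b\<^sup>2 / e + e * (f x)\<^sup>2))"
      by (intro add_mono mult_mono 1 2 R PR'[OF x]) auto
    also have "\<dots> = R * ((2 + 2 / e) * a\<^sup>2 + (1 + 1 / e) * b\<^sup>2 + e * (2 * (f x)\<^sup>2 + (g x)\<^sup>2))"
      by (simp add: field_simps)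
    finally show ?thesis by (simp add: a_def b_def)
  qed
  define C where "C = 2 * (LINT x|?M. (f x)\<^sup>2) + (LINT x|?M. (g x)\<^sup>2)"
  have small: "\<bar>LINT x|?M. ?D x\<bar> \<le> R * (e * C)" if "0 < e" for e
  proof (rule LIMSEQ_le_const)
    have "(\<lambda>n. R * ((2 + 2 / e) * ?A n + (1 + 1 / e) * ?B n + e * C) + \<bar>LINT x|?M. ?Dn n x\<bar>)
        \<longlonglongrightarrow> R * ((2 + 2 / e) * 0 + (1 + 1 / e) * 0 + e * C) + 0"
      by (intro tendsto_add tendsto_mult tendsto_const AB limDn)
    then show "(\<lambda>n. R * ((2 + 2 / e) * ?A n + (1 + 1 / e) * ?B n + e * C) + \<bar>LINT x|?M. ?Dn n x\<bar>)
        \<longlonglongrightarrow> R * (e * C)" by simp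
    show "\<exists>N. \<forall>n\<ge>N. \<bar>LINT x|?M. ?D x\<bar>
        \<le> R * ((2 + 2 / e) * ?A n + (1 + 1 / e) * ?B n + e * C) + \<bar>LINT x|?M. ?Dn n x\<bar>"
    proof (intro exI allI impI)
      fix n
      let ?E = "\<lambda>x. R * ((2 + 2 / e) * (\<phi> n x - f x)\<^sup>2 + (1 + 1 / e) * (?d n x - g x)\<^sup>2 + e * (2 * (f x)\<^sup>2 + (g x)\<^sup>2))"
      have "\<bar>(LINT x|?M. ?Dn n x) - (LINT x|?M. ?D x)\<bar> = \<bar>LINT x|?M. ?Dn n x - ?D x\<bar>"
        using Dn_int[of n] D_int by (simp only: Bochner_Integration.integral_diff)
      also have "\<dots> \<le> (LINT x|?M. \<bar>?Dn n x - ?D x\<bar>)" by (rule integral_abs_bound)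
      also have "\<dots> \<le> (LINT x|?M. ?E x)"
      proof (rule Bochner_Integration.integral_mono)
        show "integrable ?M (\<lambda>x. \<bar>?Dn n x - ?D x\<bar>)"
          by (intro integrable_abs Bochner_Integration.integrable_diff Dn_int D_int)
        show "integrable ?M ?E"
          by (intro integrable_mult_right Bochner_Integration.integrable_add a2 b2 f2 g2)
      qed (rule pointwise[OF that])
      also have "\<dots> = R * ((2 + 2 / e) * ?A n + (1 + 1 / e) * ?B n + e * C)"
        using a2[of n] b2[of n] f2 g2 by (simp add: C_def)
      finally show "\<bar>LINT x|?M. ?D x\<bar>
        \<le> R * ((2 + 2 / e) * ?A n + (1 + 1 / e) * ?B n + e * C) + \<bar>LINT x|?M. ?Dn n x\<bar>" by linarith
    qed
  qed
  have "0 \<le> C" unfolding C_def by (intro add_nonneg_nonneg mult_nonneg_nonneg Bochner_Integration.integral_nonneg) auto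
  have "\<bar>LINT x|?M. ?D x\<bar> \<le> 0"
  proof (rule field_le_epsilon)
    fix e :: real assume "0 < e"
    \<comment> \<open>The summand 1 allows division also when R * C = 0.\<close>
    have "0 < R * C + 1" using R \<open>0 \<le> C\<close> by (simp add: add_nonneg_pos)
    have "\<bar>LINT x|?M. ?D x\<bar> \<le> R * (e / (R * C + 1) * C)"
      by (rule small) (use \<open>0 < e\<close> \<open>0 < R * C + 1\<close> in simp)
    also have "\<dots> \<le> e" using \<open>0 < e\<close> \<open>0 < R * C + 1\<close> by (simp add: field_simps)
    finally show "\<bar>LINT x|?M. ?D x\<bar> \<le> 0 + e" by simp
  qed
  then show "(LINT x|?M. ?D x) = 0" by simp
qed

lemma DERIV_mult_abs: "((\<lambda>s::real. s * \<bar>s\<bar>) has_real_derivative 2 * \<bar>s\<bar>) (at s)"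
proof (cases s "0 :: real" rule: linorder_cases)
  case less
  have "((\<lambda>s. - (s\<^sup>2)) has_real_derivative 2 * \<bar>s\<bar>) (at s)"
    using less by (auto intro!: derivative_eq_intros)
  then show ?thesis
    by (rule has_field_derivative_transform_within_open[of _ _ _ "{..<0}"])
      (use less in \<open>auto simp: power2_eq_square\<close>)
next
  case greater
  have "((\<lambda>s. s\<^sup>2) has_real_derivative 2 * \<bar>s\<bar>) (at s)"
    using greater by (auto intro!: derivative_eq_intros)
  then show ?thesis
    by (rule has_field_derivative_transform_within_open[of _ _ _ "{0<..}"])
      (use greater in \<open>auto simp: power2_eq_square\<close>)
next
  case equal
  have "((\<lambda>h::real. \<bar>h\<bar>) \<longlongrightarrow> \<bar>0\<bar>) (at 0)" by (intro tendsto_intros)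
  moreover have "\<forall>\<^sub>F h in at 0. \<bar>h\<bar> = ((0 + h) * \<bar>0 + h\<bar> - 0 * \<bar>0\<bar>) / (h::real)"
    by (auto simp: eventually_at intro!: exI[of _ 1])
  ultimately have "((\<lambda>h::real. ((0 + h) * \<bar>0 + h\<bar> - 0 * \<bar>0\<bar>) / h) \<longlongrightarrow> \<bar>0\<bar>) (at 0)"
    by (rule Lim_transform_eventually)
  then show ?thesis using equal by (simp add: DERIV_def)
qed

lemma zero_trace_sign_rigidity:
  fixes f g :: "real^2 \<Rightarrow> real"
  assumes \<omega>: "open \<omega>" "bounded \<omega>" and tr: "has_trace \<omega> f (\<lambda>_. 0)"
    and w: "AE x in lebesgue_on \<omega>. weak_partial \<omega> i f x \<le> 0"
  shows "AE x in lebesgue_on \<omega>. f x = 0" and "AE x in lebesgue_on \<omega>. weak_partial \<omega> i f x = 0"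
proof -
  let ?M = "lebesgue_on \<omega>"
  have "f \<in> H1 \<omega>" using tr by (simp add: has_trace_def)
  then obtain g where g: "g \<in> L2 \<omega>" "has_weak_partial \<omega> i f g" by (auto simp: H1_def)
  \<comment> \<open>The sign condition is moved to the square-integrable representative
    \<open>g\<close>.\<close>
  have gw: "AE x in ?M. g x = weak_partial \<omega> i f x"
    by (rule has_weak_partial_unique[OF \<omega>(1) g(2) has_weak_partial_weak_partial[OF g(2)]])
  then have neg: "AE x in ?M. g x \<le> 0" using w by eventually_elim simp
  have key: "\<bar>a * \<bar>a\<bar> - b * \<bar>b\<bar>\<bar> \<le> \<bar>a - b\<bar> * (\<bar>a - b\<bar> + 2 * \<bar>b\<bar>)" for a b :: real
  proof -
    have "a * \<bar>a\<bar> - b * \<bar>b\<bar> = (a - b) * \<bar>a\<bar> + b * (\<bar>a\<bar> - \<bar>b\<bar>)" by (simp add: algebra_simps)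
    then have "\<bar>a * \<bar>a\<bar> - b * \<bar>b\<bar>\<bar> \<le> \<bar>a - b\<bar> * \<bar>a\<bar> + \<bar>b\<bar> * \<bar>\<bar>a\<bar> - \<bar>b\<bar>\<bar>"
      using abs_triangle_ineq[of "(a - b) * \<bar>a\<bar>" "b * (\<bar>a\<bar> - \<bar>b\<bar>)"] by (simp add: abs_mult)
    also have "\<dots> \<le> \<bar>a - b\<bar> * (\<bar>a - b\<bar> + \<bar>b\<bar>) + \<bar>b\<bar> * \<bar>a - b\<bar>"
      by (intro add_mono mult_left_mono abs_triangle_ineq3) auto
    finally show ?thesis by (simp add: algebra_simps)
  qed
  have abs_lip: "\<bar>2 * \<bar>a\<bar> - 2 * \<bar>b\<bar>\<bar> \<le> 2 * \<bar>a - b\<bar>" for a b :: real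
    by (simp add: abs_if)
  have abs_cont: "continuous_on UNIV (\<lambda>s::real. 2 * \<bar>s\<bar>)" by (intro continuous_intros)
  \<comment> \<open>The weight -1 makes the integrand -2 |f| g, which is nonnegative, so a zero
    integral forces it to vanish almost everywhere.\<close>
  note 1 = integral_partial_zero_trace[OF \<omega> tr g, where H = "\<lambda>s. s * \<bar>s\<bar>" and h = "\<lambda>s. 2 * \<bar>s\<bar>" and p = "-1" and q = 0,
      OF DERIV_mult_abs _ key _ abs_lip abs_cont]
  have "integrable ?M (\<lambda>x. - (2 * \<bar>f x\<bar> * g x))" "(LINT x|?M. - (2 * \<bar>f x\<bar> * g x)) = 0"
    using 1 by (simp_all add: power2_eq_square abs_mult)
  moreover have "AE x in ?M. 0 \<le> - (2 * \<bar>f x\<bar> * g x)"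
    using neg by eventually_elim (auto simp: mult_nonneg_nonpos)
  ultimately have "AE x in ?M. - (2 * \<bar>f x\<bar> * g x) = 0"
    using integral_nonneg_eq_0_iff_AE by blast
  then have fg: "AE x in ?M. f x * g x = 0" by eventually_elim auto
  have sq: "\<bar>a\<^sup>2 - b\<^sup>2\<bar> \<le> \<bar>a - b\<bar> * (\<bar>a - b\<bar> + 2 * \<bar>b\<bar>)" for a b :: real
  proof -
    have "a\<^sup>2 - b\<^sup>2 = (a - b) * ((a - b) + 2 * b)" by (simp add: algebra_simps power2_eq_square)
    then show ?thesis by (simp add: abs_mult mult_left_mono)
  qed
  have dsq: "((\<lambda>s::real. s\<^sup>2) has_real_derivative 2 * s) (at s)" for s
    by (auto intro!: derivative_eq_intros)
  have id_lip: "\<bar>2 * a - 2 * b\<bar> \<le> 2 * \<bar>a - b\<bar>" for a b :: real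
    by (simp add: abs_if)
  have id_cont: "continuous_on UNIV (\<lambda>s::real. 2 * s)" by (intro continuous_intros)
  \<comment> \<open>The weight y_i gives f^2 + 2 y_i f g; the second term is zero by
    \<open>fg\<close>, and no sign of y_i matters.\<close>
  note 2 = integral_partial_zero_trace[OF \<omega> tr g, where H = "\<lambda>s. s\<^sup>2" and h = "\<lambda>s. 2 * s" and p = 0 and q = 1,
      OF dsq _ sq _ id_lip id_cont]
  have 3: "integrable ?M (\<lambda>x. (f x)\<^sup>2 + x $ i * (2 * f x * g x))" "(LINT x|?M. (f x)\<^sup>2 + x $ i * (2 * f x * g x)) = 0"
    using 2 by (simp_all add: abs_mult)
  have AE: "AE x in ?M. (f x)\<^sup>2 + x $ i * (2 * f x * g x) = (f x)\<^sup>2"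
    using fg by eventually_elim auto
  have f2: "integrable ?M (\<lambda>x. (f x)\<^sup>2)" using \<open>f \<in> H1 \<omega>\<close> by (simp add: H1_def L2_def)
  have "(LINT x|?M. (f x)\<^sup>2) = 0"
    using integral_cong_AE[OF borel_measurable_integrable[OF 3(1)] borel_measurable_integrable[OF f2] AE] 3(2) by simp
  then have "AE x in ?M. (f x)\<^sup>2 = 0"
    using integral_nonneg_eq_0_iff_AE[OF f2] by simp
  then show f0: "AE x in ?M. f x = 0" by eventually_elim simp
  show "AE x in ?M. weak_partial \<omega> i f x = 0"
    by (rule has_weak_partial_AE_zero[OF \<omega>(1) has_weak_partial_weak_partial[OF g(2)] f0])
qed

theorem theorem4:
  fixes \<omega> :: "(real^2) set"
    and V_H :: "(2 \<Rightarrow> real^2 \<Rightarrow> real) set"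
    and V_3 :: "(real^2 \<Rightarrow> real) set"
  assumes "open \<omega>" and "bounded \<omega>" and "connected \<omega>" and "lipschitz_boundary \<omega>"
    and "V_H \<subseteq> {uH. \<forall>\<alpha>. uH \<alpha> \<in> H1 \<omega>}"
    and "V_3 \<subseteq> H2 \<omega>"
    and "\<And>u3. u3 \<in> V_3 \<Longrightarrow> (\<forall>\<alpha>. AE y in lebesgue_on \<omega>. weak_partial \<omega> \<alpha> u3 y = 0) \<Longrightarrow>
           (AE y in lebesgue_on \<omega>. u3 y = 0)"
    and "\<And>uH. uH \<in> V_H \<Longrightarrow> (\<forall>\<alpha>. has_trace \<omega> (uH \<alpha>) (\<lambda>_. 0))"
  shows "\<forall>(uH, u3) \<in> V_H \<times> V_3.
           (AE y in lebesgue_on \<omega>. strain \<omega> (uH, u3) y = 0) \<longrightarrow>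
           (\<forall>\<alpha>. AE y in lebesgue_on \<omega>. uH \<alpha> y = 0) \<and> (AE y in lebesgue_on \<omega>. u3 y = 0)"
proof (clarify)
  fix uH u3
  assume u: "uH \<in> V_H" "u3 \<in> V_3" and strain: "AE y in lebesgue_on \<omega>. strain \<omega> (uH, u3) y = 0"
  have diag: "AE y in lebesgue_on \<omega>. 2 * weak_partial \<omega> \<alpha> (uH \<alpha>) y + (weak_partial \<omega> \<alpha> u3 y)\<^sup>2 = 0" for \<alpha>
    using strain
  proof eventually_elim
    case (elim y)
    then have "strain \<omega> (uH, u3) y $ \<alpha> $ \<alpha> = 0" by simp
    then show ?case by (simp add: strain_def power2_eq_square)
  qed
  have neg: "AE y in lebesgue_on \<omega>. weak_partial \<omega> \<alpha> (uH \<alpha>) y \<le> 0" for \<alpha>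
    using diag[of \<alpha>]
  proof eventually_elim
    case (elim y)
    then show ?case using zero_le_power2[of "weak_partial \<omega> \<alpha> u3 y"] by linarith
  qed
  have tr: "has_trace \<omega> (uH \<alpha>) (\<lambda>_. 0)" for \<alpha> using assms(8) u(1) by blast
  \<comment> \<open>\<open>rigid(2)\<close> concerns only the derivative of each horizontal
    component in its own direction, which is all that \<open>diag\<close> involves.\<close>
  note rigid = zero_trace_sign_rigidity[OF assms(1,2) tr neg]
  have "AE y in lebesgue_on \<omega>. weak_partial \<omega> \<alpha> u3 y = 0" for \<alpha>
    using diag[of \<alpha>] rigid(2)[of \<alpha>] by eventually_elim simp
  then show "(\<forall>\<alpha>. AE y in lebesgue_on \<omega>. uH \<alpha> y = 0) \<and> (AE y in lebesgue_on \<omega>. u3 y = 0)"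
    using rigid(1) assms(7)[OF u(2)] by blast
qed

end
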